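(* Let $n\geq1$. (1) Suppose $w=C_k(s_n)$ for some $k\in[0,q_{n-1}-2]$, so that $w=uv_{n-2}v$ with $vu=w_{n-1}$ and $|v|=k+1$. Then \[ c_\alpha=\Big(\prod_{j=-1}^{n-3}v_j\Big)u^{-1}\,w^{(1)}z_1w^{(2)}z_2w^{(3)}z_3\cdots, \] where $\mathbf{z}=z_1z_2z_3\cdots$ is $c_{\alpha_{n,1}}\{\varepsilon,(uU_{n-1,d_n-2}v)^{-1}\}$. (2) Suppose $w=C_k(s_n)$ for some $k\in[q_{n-1}-1,q_n-1]$, so that $w=uw_{n-1}v$ with $vu=v_{n-2}$ and $|v|=k+1-q_{n-1}$. Then \[ c_\alpha=\Big(\prod_{j=-1}^{n-2}v_j\Big)u^{-1}\,w^{(1)}z_1w^{(2)}z_2w^{(3)}z_3\cdots, \] where $\mathbf{z}=z_1z_2z_3\cdots$ is $c_{\alpha_{n}}\{\varepsilon,v^{-1}w_nu^{-1}\}$.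
   Context: Words are over $\{a,b\}$, embedded in the free group $\mathcal{F}$ on $\{a,b\}$; $x^{-1}$ is the inverse of a word $x$, $|x^{-1}|:=-|x|$; $\varepsilon$ is the empty word. Products $\prod_{j=m}^M x_j=x_m\cdots x_M$ (empty product $=\varepsilon$). For a word $w=x_1\cdots x_m$ and $0\le k\le m-1$, the $k$-th conjugate is $C_k(w)=x_{k+1}\cdots x_mx_1\cdots x_k$. For an irrational $\gamma\in(0,1)$, $c_\gamma$ is the infinite word with $c_\gamma(n)=a$ if $\lfloor (n+2)\gamma\rfloor-\lfloor (n+1)\gamma\rfloor=0$ and $b$ otherwise. For $\gamma=[0;a_1,a_2,\ldots]$, $n\in\mathbb{N}$, integer $k\ge1-a_{n+1}$: $\gamma_{n,k}=[0;a_{n+1}+k,a_{n+2},\ldots]$ and $\gamma_n=\gamma_{n,0}$. $\mathbf{c}\{x,y\}$ denotes the sequence obtained from $\mathbf{c}$ by replacing $a$ by $x$ and $b$ by $y$. Standing assumption: $\alpha=[0;1+d_1,d_2,d_3,\ldots]$ irrational, all integers $d_i\ge1$. $s_{-1}=b$, $s_0=a$, $s_n=s_{n-1}^{d_n}s_{n-2}$; $q_n=|s_n|$ ($n\ge0$), $q_{-1}=1$; $c_\alpha=\lim s_n$. $w_{-2}=\varepsilon$, $w_{-1}=a$, for $n\ge0$: $w_n=as_nb^{-1}$ ($n$ odd), $w_n=bs_na^{-1}$ ($n$ even). $v_{-2}=\varepsilon$, for $n\ge-1$: $v_n=as_{n+1}^{d_{n+2}-1}s_nb^{-1}$ ($n$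 odd), $v_n=bs_{n+1}^{d_{n+2}-1}s_na^{-1}$ ($n$ even). For $n\ge0$ and $-1\le k\le d_{n+1}-1$: $U_{n,k}=(w_{n-1}v_{n-2})^kw_{n-1}$ for $k\ge0$, and $U_{n,-1}=(v_{n-2})^{-1}$. Decomposition notation: $c_\alpha=P\,w^{(1)}z_1w^{(2)}z_2\cdots$ (with $P$ a word, $z_i\in\mathcal{F}$) means $c_\alpha$ is the limit of the free-group products $Pwz_1wz_2\cdots wz_i$ where $w^{(i)}$ is the $i$-th occurrence of $w$; equivalently, the positions (starting from $0$) at which $w$ occurs in $c_\alpha$ are exactly $p_1<p_2<\cdots$ with $p_1=|P|$, $p_{i+1}=p_i+|w|+|z_i|$. *)

theory Defs
  imports Complex_Main
begin

text \<open>
  A signed word is a list of pairs (x, True), standing for x, and (x, False), standing for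
  the inverse of x.  The free group consists of the signed words modulo insertion and
  deletion of adjacent mutually inverse letters.
\<close>

type_synonym 'a signed_word = "('a \<times> bool) list"

inductive cancels :: "'a signed_word \<Rightarrow> 'a signed_word \<Rightarrow> bool" where
  "cancels (xs @ [(x, e), (x, \<not> e)] @ ys) (xs @ ys)"

definition fg_eq :: "'a signed_word \<Rightarrow> 'a signed_word \<Rightarrow> bool" where
  "fg_eq = equivclp cancels"

definition fg_flip :: "'a signed_word \<Rightarrow> 'a signed_word" where
  "fg_flip xs = rev (map (\<lambda>(x, e). (x, \<not> e)) xs)"

definition exponent_sum :: "'a signed_word \<Rightarrow> int" where
  "exponent_sum xs = (\<Sum>(x, e)\<leftarrow>xs. if e then 1 else - 1)"

lemma fg_eq_refl: "fg_eq xs xs"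
  by (simp add: fg_eq_def)

lemma fg_eq_sym: "fg_eq xs ys \<Longrightarrow> fg_eq ys xs"
  by (simp add: fg_eq_def equivclp_sym)

lemma fg_eq_trans: "fg_eq xs ys \<Longrightarrow> fg_eq ys zs \<Longrightarrow> fg_eq xs zs"
  unfolding fg_eq_def by (rule equivclp_trans)

lemma cancels_imp_fg_eq: "cancels xs ys \<Longrightarrow> fg_eq xs ys"
  by (auto simp: fg_eq_def)

lemma fg_eq_map:
  assumes "fg_eq xs ys"
    and step: "\<And>xs ys. cancels xs ys \<Longrightarrow> fg_eq (f xs) (f ys)"
  shows "fg_eq (f xs) (f ys)"
  using assms(1) unfolding fg_eq_def
proof (induction rule: equivclp_induct)
  case base
  show ?case by simp
next
  case (step y z)
  then have "fg_eq (f y) (f z)"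
    using assms(2) fg_eq_sym by blast
  with step show ?case
    unfolding fg_eq_def using equivclp_trans by metis
qed

lemma cancels_append1: "cancels xs ys \<Longrightarrow> cancels (xs @ zs) (ys @ zs)"
proof (induction rule: cancels.induct)
  case (1 xs x e ys)
  show ?case using cancels.intros[of xs x e "ys @ zs"] by simp
qed

lemma cancels_append2: "cancels xs ys \<Longrightarrow> cancels (zs @ xs) (zs @ ys)"
proof (induction rule: cancels.induct)
  case (1 xs x e ys)
  show ?case using cancels.intros[of "zs @ xs" x e ys] by simp
qed

lemma cancels_fg_flip: "cancels xs ys \<Longrightarrow> cancels (fg_flip xs) (fg_flip ys)"
proof (induction rule: cancels.induct)
  case (1 xs x e ys)
  show ?case using cancels.intros[of "fg_flip ys" x e "fg_flip xs"] by (simp add: fg_flip_def)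
qed

lemma fg_eq_append:
  assumes "fg_eq xs xs'" "fg_eq ys ys'"
  shows "fg_eq (xs @ ys) (xs' @ ys')"
proof -
  have "fg_eq (xs @ ys) (xs' @ ys)"
    using assms(1) by (rule fg_eq_map) (intro cancels_imp_fg_eq cancels_append1)
  moreover have "fg_eq (xs' @ ys) (xs' @ ys')"
    using assms(2) by (rule fg_eq_map) (intro cancels_imp_fg_eq cancels_append2)
  ultimately show ?thesis by (rule fg_eq_trans)
qed

lemma fg_eq_fg_flip: "fg_eq xs ys \<Longrightarrow> fg_eq (fg_flip xs) (fg_flip ys)"
  by (erule fg_eq_map) (intro cancels_imp_fg_eq cancels_fg_flip)

lemma fg_eq_exponent_sum: "fg_eq xs ys \<Longrightarrow> exponent_sum xs = exponent_sum ys"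
  unfolding fg_eq_def
proof (induction rule: equivclp_induct)
  case (step y z)
  have "exponent_sum xs = exponent_sum ys" if "cancels xs ys" for xs ys :: "'a signed_word"
    using that by cases (auto simp: exponent_sum_def)
  with step show ?case by metis
qed simp

quotient_type 'a free_group = "'a signed_word" / fg_eq
proof (rule equivpI)
  show "reflp (fg_eq :: 'a signed_word \<Rightarrow> _)" by (rule reflpI) (rule fg_eq_refl)
  show "symp (fg_eq :: 'a signed_word \<Rightarrow> _)" by (rule sympI) (rule fg_eq_sym)
  show "transp (fg_eq :: 'a signed_word \<Rightarrow> _)" by (rule transpI) (rule fg_eq_trans)
qed

instantiation free_group :: (type) "{monoid_mult, inverse}"
begin

lift_definition one_free_group :: "'a free_group" is "[]" .

lift_definition times_free_group :: "'a free_group \<Rightarrow> 'a free_group \<Rightarrow> 'a free_group"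
  is "(@)" by (rule fg_eq_append)

lift_definition inverse_free_group :: "'a free_group \<Rightarrow> 'a free_group"
  is fg_flip by (rule fg_eq_fg_flip)

definition divide_free_group :: "'a free_group \<Rightarrow> 'a free_group \<Rightarrow> 'a free_group" where
  "divide_free_group x y = x * inverse y"

instance
  by standard (transfer, simp add: fg_eq_refl)+

end

lemma fg_eq_append_fg_flip: "fg_eq (xs @ fg_flip xs) []"
proof (induction xs)
  case Nil
  show ?case by (simp add: fg_flip_def fg_eq_refl)
next
  case (Cons p xs)
  obtain x e where p: "p = (x, e)" by force
  have "fg_eq ([(x, e)] @ (xs @ fg_flip xs) @ [(x, \<not> e)]) ([(x, e)] @ [] @ [(x, \<not> e)])"
    by (intro fg_eq_append Cons.IH fg_eq_refl)
  moreover have "fg_eq [(x, e), (x, \<not> e)] []"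
    using cancels_imp_fg_eq[OF cancels.intros[of "[]" x e "[]"]] by simp
  ultimately show ?case
    using fg_eq_trans by (fastforce simp: p fg_flip_def)
qed

lemma free_group_right_inverse: "x * inverse x = 1" for x :: "'a free_group"
  by transfer (rule fg_eq_append_fg_flip)

lemma free_group_left_inverse: "inverse x * x = 1" for x :: "'a free_group"
proof transfer
  fix xs :: "'a signed_word"
  have "fg_flip (fg_flip xs) = xs" by (simp add: fg_flip_def rev_map comp_def case_prod_beta)
  then show "fg_eq (fg_flip xs @ xs) []" using fg_eq_append_fg_flip[of "fg_flip xs"] by simp
qed

text \<open>
  The length of a group element: it is additive, extends the length of words, and changes
  sign under inversion.
\<close>

lift_definition fg_length :: "'a free_group \<Rightarrow> int" is exponent_sum
  by (rule fg_eq_exponent_sum)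

lemma fg_length_mult: "fg_length (x * y) = fg_length x + fg_length y"
  by transfer (simp add: exponent_sum_def)

definition positive :: "'a list \<Rightarrow> 'a signed_word" where
  "positive xs = map (\<lambda>x. (x, True)) xs"

lift_definition word :: "'a list \<Rightarrow> 'a free_group" is positive .

lemma fg_length_word: "fg_length (word xs) = int (length xs)"
proof transfer
  fix xs :: "'a list"
  show "exponent_sum (positive xs) = int (length xs)"
    by (induction xs) (simp_all add: exponent_sum_def positive_def)
qed

definition reduced :: "'a signed_word \<Rightarrow> bool" where
  "reduced xs \<longleftrightarrow> successively (\<lambda>(x, e) (y, f). \<not> (x = y \<and> f = (\<not> e))) xs"

type_synonym 'a infinite_word = "nat \<Rightarrow> 'a"

text \<open>
  A sequence of group elements tends to an infinite word if, for every N, the reduced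
  forms of its members eventually begin with the prefix of length N of that word.
\<close>

definition tends_to_word :: "(nat \<Rightarrow> 'a free_group) \<Rightarrow> 'a infinite_word \<Rightarrow> bool" where
  "tends_to_word x c \<longleftrightarrow>
     (\<forall>N. \<forall>\<^sub>F i in sequentially. \<exists>ys.
        reduced (positive (map c [0..<N]) @ ys) \<and>
        x i = abs_free_group (positive (map c [0..<N]) @ ys))"

definition occurs_at :: "'a list \<Rightarrow> 'a infinite_word \<Rightarrow> nat \<Rightarrow> bool" where
  "occurs_at w c i \<longleftrightarrow> (\<forall>j < length w. c (i + j) = w ! j)"

text \<open>
  c = P w z(0) w z(1) w z(2) ..., where the displayed copies of w are all the occurrences
  of w in c, in increasing order of position; their positions are p(0) < p(1) < ...
\<close>

definition decomposition ::
  "'a infinite_word \<Rightarrow> 'a free_group \<Rightarrow> 'a list \<Rightarrow> (nat \<Rightarrow> 'a free_group) \<Rightarrow> bool" where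
  "decomposition c P w z \<longleftrightarrow>
     P \<in> range word \<and>
     tends_to_word (\<lambda>i. P * (\<Prod>j\<leftarrow>[0..<i]. word w * z j)) c \<and>
     (\<exists>p. strict_mono p \<and> range p = {i. occurs_at w c i} \<and>
          int (p 0) = fg_length P \<and>
          (\<forall>i. int (p (Suc i)) = int (p i) + int (length w) + fg_length (z i)))"

datatype letter = A | B

text \<open>Partial quotients are indexed from 1; the values at index 0 are irrelevant.\<close>

fun convergent_cf :: "(nat \<Rightarrow> nat) \<Rightarrow> nat \<Rightarrow> real" where
  "convergent_cf a 0 = 0"
| "convergent_cf a (Suc m) = 1 / (real (a 1) + convergent_cf (\<lambda>i. a (Suc i)) m)"

definition cf :: "(nat \<Rightarrow> nat) \<Rightarrow> real" where
  "cf a = lim (convergent_cf a)"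

text \<open>[0; a(n+1) + k, a(n+2), a(n+3), ...], for an integer k with k >= 1 - a(n+1).\<close>

definition cf_tail :: "(nat \<Rightarrow> nat) \<Rightarrow> nat \<Rightarrow> int \<Rightarrow> real" where
  "cf_tail a n k = cf (\<lambda>i. if i = 1 then nat (int (a (n + 1)) + k) else a (n + i))"

definition char_word :: "real \<Rightarrow> letter infinite_word" where
  "char_word \<gamma> n =
     (if \<lfloor>real (n + 2) * \<gamma>\<rfloor> - \<lfloor>real (n + 1) * \<gamma>\<rfloor> = 0 then A else B)"

definition subst_word :: "letter infinite_word \<Rightarrow> 'b \<Rightarrow> 'b \<Rightarrow> nat \<Rightarrow> 'b" where
  "subst_word c x y i = (case c i of A \<Rightarrow> x | B \<Rightarrow> y)"

text \<open>[0; 1 + d(1), d(2), d(3), ...]\<close>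

definition quotients :: "(nat \<Rightarrow> nat) \<Rightarrow> nat \<Rightarrow> nat" where
  "quotients d = d(1 := 1 + d 1)"

text \<open>The index of the standard words is shifted by one, so that it starts from 0.\<close>

fun s_shifted :: "(nat \<Rightarrow> nat) \<Rightarrow> nat \<Rightarrow> letter list" where
  "s_shifted d 0 = [B]"
| "s_shifted d (Suc 0) = [A]"
| "s_shifted d (Suc (Suc n)) =
     concat (replicate (d (Suc n)) (s_shifted d (Suc n))) @ s_shifted d n"

definition s_word :: "(nat \<Rightarrow> nat) \<Rightarrow> int \<Rightarrow> letter list" where
  "s_word d n = s_shifted d (nat (n + 1))"

definition q_len :: "(nat \<Rightarrow> nat) \<Rightarrow> int \<Rightarrow> int" where
  "q_len d n = int (length (s_word d n))"

lemma s_word_simps: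
  "s_word d (- 1) = [B]"
  "s_word d 0 = [A]"
  "n \<ge> 1 \<Longrightarrow> s_word d n = concat (replicate (d (nat n)) (s_word d (n - 1))) @ s_word d (n - 2)"
proof -
  assume "n \<ge> 1"
  then obtain m where "n = int (Suc m)" by (metis Suc_le_D nat_0_le nat_mono
    nat_one_as_int of_nat_1 of_nat_le_iff One_nat_def zero_le_imp_eq_int dual_order.trans zero_le_one)
  then show "s_word d n = concat (replicate (d (nat n)) (s_word d (n - 1))) @ s_word d (n - 2)"
    by (simp add: s_word_def nat_add_distrib)
qed (simp_all add: s_word_def)

text \<open>The index n of w and v starts from -2; for n >= 0 the values are positive words.\<close>

definition w_word :: "(nat \<Rightarrow> nat) \<Rightarrow> int \<Rightarrow> letter free_group" where
  "w_word d n =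
     (if n = - 2 then 1
      else if n = - 1 then word [A]
      else if odd n then word [A] * word (s_word d n) * inverse (word [B])
      else word [B] * word (s_word d n) * inverse (word [A]))"

definition v_word :: "(nat \<Rightarrow> nat) \<Rightarrow> int \<Rightarrow> letter free_group" where
  "v_word d n =
     (if n = - 2 then 1
      else if odd n then
        word [A] * word (s_word d (n + 1)) ^ (d (nat (n + 2)) - 1) * word (s_word d n) * inverse (word [B])
      else
        word [B] * word (s_word d (n + 1)) ^ (d (nat (n + 2)) - 1) * word (s_word d n) * inverse (word [A]))"

definition U_word :: "(nat \<Rightarrow> nat) \<Rightarrow> int \<Rightarrow> int \<Rightarrow> letter free_group" where
  "U_word d n k =
     (if k = - 1 then inverse (v_word d (n - 2))
      else (w_word d (n - 1) * v_word d (n - 2)) ^ nat k * w_word d (n - 1))"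

end

theory Submission
  imports Defs
begin

text \<open>
  Write x(n) for the last letter of s(n).  The word c with slope alpha is the image of the
  characteristic word of slope alpha(n,1) under A to s(n), B to s(n-1), in which every block s(n-1)
  is followed by s(n).  Since s(n) s(n-1) and s(n-1) s(n) agree up to their last two letters, the
  factor of length q(n) at offset k of a block s(n) is the k-th conjugate of s(n), and the same holds
  for a block s(n-1) unless k is its last offset, where the factor has the wrong number of letters A.
  As the conjugates of s(n) are distinct, this determines all their occurrences: if k is at most
  q(n-1)-2 both kinds of blocks contribute, otherwise only the blocks s(n).  Finally, in the free
  group w(n) and v(n) are conjugates of quotients of the s(m) by letters x(m), so each factor w z(i)
  becomes a block of c after conjugation with the prefix P.
\<close>

section \<open>The free group\<close>

interpretation free_group: group "(*)" "1 :: 'a free_group" inverse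
  by standard (simp_all add: free_group_left_inverse)

lemma free_group_cancel:
  fixes x y :: "'a free_group"
  shows "x * (inverse x * y) = y" "inverse x * (x * y) = y"
  by (simp_all add: free_group_left_inverse free_group_right_inverse flip: mult.assoc)

lemmas free_group_simps = mult.assoc free_group_cancel free_group_left_inverse
  free_group_right_inverse free_group.inverse_distrib_swap

lemma word_Nil: "word [] = 1"
  by transfer (simp add: positive_def fg_eq_refl)

lemma word_append: "word (xs @ ys) = word xs * word ys"
  by transfer (simp add: positive_def fg_eq_refl)

lemma word_Cons: "word (x # xs) = word [x] * word xs"
  using word_append[of "[x]" xs] by simp

lemma word_concat_replicate: "word (concat (replicate m xs)) = word xs ^ m"
  by (induction m) (simp_all add: word_Nil word_append)

section \<open>Reduced forms and the embedding of words\<close>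

definition reduce_cons :: "'a \<times> bool \<Rightarrow> 'a signed_word \<Rightarrow> 'a signed_word" where
  "reduce_cons p xs = (if xs \<noteq> [] \<and> hd xs = (fst p, \<not> snd p) then tl xs else p # xs)"

text \<open>Letters act on reduced words by \<open>reduce_cons\<close>. Letting a signed word act on
  the empty one gives a normal form of its group element.\<close>

definition reduction :: "'a signed_word \<Rightarrow> 'a signed_word" where
  "reduction xs = foldr reduce_cons xs []"

lemma reduced_reduce_cons: "reduced xs \<Longrightarrow> reduced (reduce_cons p xs)"
  by (cases xs; cases "tl xs"; cases p)
    (auto simp: reduced_def reduce_cons_def split: prod.splits)

lemma reduced_foldr_reduce_cons: "reduced xs \<Longrightarrow> reduced (foldr reduce_cons ys xs)"
  by (induction ys) (auto intro: reduced_reduce_cons)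

text \<open>If the inner step deletes the head of \<open>xs\<close>, reducedness ensures that the
  outer step restores it instead of cancelling once more. So inverse letters act as inverse maps on
  reduced words, and \<open>reduction\<close> is invariant under \<open>cancels\<close>.\<close>

lemma reduce_cons_cancel:
  assumes "reduced xs"
  shows "reduce_cons (x, e) (reduce_cons (x, \<not> e) xs) = xs"
  using assms by (cases xs; cases "tl xs")
    (auto simp: reduced_def reduce_cons_def split: prod.splits)

lemma reduction_cancels: "cancels xs ys \<Longrightarrow> reduction xs = reduction ys"
proof (induction rule: cancels.induct)
  case (1 xs x e ys)
  have "reduced (foldr reduce_cons ys [])"
    by (rule reduced_foldr_reduce_cons) (simp add: reduced_def)
  then show ?case by (simp add: reduction_def reduce_cons_cancel)
qed

lemma reduction_fg_eq: "fg_eq xs ys \<Longrightarrow> reduction xs = reduction ys"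
  unfolding fg_eq_def
  by (induction rule: equivclp_induct) (auto dest: reduction_cancels)

lemma reduction_positive: "reduction (positive xs) = positive xs"
  by (induction xs) (auto simp: reduction_def positive_def reduce_cons_def hd_map)

text \<open>A positive word is its own normal form. This later turns the hypotheses on
  \<open>word v * word u\<close> into equations between lists.\<close>

lemma inj_word: "word xs = word ys \<Longrightarrow> xs = ys"
proof transfer
  fix xs ys :: "'a list"
  assume "fg_eq (positive xs) (positive ys)"
  then have "positive xs = positive ys"
    by (metis reduction_fg_eq reduction_positive)
  then show "xs = ys"
    by (auto simp: positive_def inj_on_def dest!: map_injective)
qed

lemma reduced_positive: "reduced (positive xs)"
  by (induction xs rule: induct_list012) (auto simp: reduced_def positive_def)

section \<open>Images of infinite words\<close>

lemma occurs_at_Nil [simp]: "occurs_at [] c i"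
  by (simp add: occurs_at_def)

lemma occurs_at_append:
  "occurs_at (u @ v) c i \<longleftrightarrow> occurs_at u c i \<and> occurs_at v c (i + length u)"
proof
  assume "occurs_at (u @ v) c i"
  then have *: "c (i + j) = (u @ v) ! j" if "j < length u + length v" for j
    using that by (simp add: occurs_at_def)
  have "c (i + length u + j) = v ! j" if "j < length v" for j
    using *[of "length u + j"] that by (simp add: add.assoc)
  moreover have "c (i + j) = u ! j" if "j < length u" for j
    using *[of j] that by (simp add: nth_append)
  ultimately show "occurs_at u c i \<and> occurs_at v c (i + length u)"
    by (simp add: occurs_at_def)
next
  assume *: "occurs_at u c i \<and> occurs_at v c (i + length u)"
  have "c (i + j) = (u @ v) ! j" if "j < length u + length v" for j
  proof (cases "j < length u")
    case True
    then show ?thesis using * by (simp add: occurs_at_def nth_append)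
  next
    case False
    then have "c (i + length u + (j - length u)) = v ! (j - length u)"
      using * that by (simp only: occurs_at_def)
    moreover have "i + length u + (j - length u) = i + j" using False by simp
    ultimately show ?thesis using False by (simp add: nth_append)
  qed
  then show "occurs_at (u @ v) c i" by (simp add: occurs_at_def)
qed

lemma occurs_at_map: "occurs_at w c i \<Longrightarrow> map c [i..<i + length w] = w"
  unfolding occurs_at_def by (rule nth_equalityI) auto

lemma occurs_at_unique:
  assumes "occurs_at u c i" "occurs_at v c i" "length u = length v"
  shows "u = v"
  using occurs_at_map[OF assms(1)] occurs_at_map[OF assms(2)] unfolding assms(3) by (rule trans[OF sym])

section \<open>Substitutions and the blocks they produce\<close>

definition morph :: "'b list \<Rightarrow> 'b list \<Rightarrow> letter list \<Rightarrow> 'b list" where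
  "morph x y us = concat (map (case_letter x y) us)"

definition block_start :: "'b list \<Rightarrow> 'b list \<Rightarrow> letter infinite_word \<Rightarrow> nat \<Rightarrow> nat" where
  "block_start x y c i = length (morph x y (map c [0..<i]))"

text \<open>In the notation of the paper, c = b{x, y}.\<close>

definition image_of :: "letter infinite_word \<Rightarrow> 'b list \<Rightarrow> 'b list \<Rightarrow> 'b infinite_word \<Rightarrow> bool" where
  "image_of b x y c \<longleftrightarrow> (\<forall>i. occurs_at (morph x y (map b [0..<i])) c 0)"

lemma morph_append: "morph x y (us @ vs) = morph x y us @ morph x y vs"
  by (simp add: morph_def)

lemma morph_Nil [simp]: "morph x y [] = []"
  by (simp add: morph_def)

lemma morph_Cons: "morph x y (u # us) = case_letter x y u @ morph x y us"
  by (simp add: morph_def)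

lemma morph_morph:
  "morph x y (morph x' y' us) = morph (morph x y x') (morph x y y') us"
  by (induction us) (simp_all add: morph_Cons morph_append split: letter.split)

lemma morph_replicate: "morph x y (replicate m A) = concat (replicate m x)"
  by (induction m) (simp_all add: morph_Cons)

lemma block_start_0 [simp]: "block_start x y c 0 = 0"
  by (simp add: block_start_def)

lemma block_start_Suc:
  "block_start x y c (Suc i) = block_start x y c i + length (case_letter x y (c i))"
  by (simp add: block_start_def morph_append morph_Cons)

lemma strict_mono_block_start:
  assumes "x \<noteq> []" "y \<noteq> []"
  shows "strict_mono (block_start x y c)"
  using assms by (auto simp: strict_mono_Suc_iff block_start_Suc split: letter.split)

lemma block_cover:
  assumes "x \<noteq> []" "y \<noteq> []"
  obtains m k where "i = block_start x y c m + k" "k < length (case_letter x y (c m))"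
proof -
  have "\<exists>m. block_start x y c m \<le> i \<and> i < block_start x y c (Suc m)"
  proof (induction i)
    case 0
    then show ?case
      using assms by (intro exI[of _ 0]) (auto simp: block_start_Suc split: letter.split)
  next
    case (Suc i)
    then obtain m where m: "block_start x y c m \<le> i" "i < block_start x y c (Suc m)" by blast
    have "block_start x y c (Suc m) < block_start x y c (Suc (Suc m))"
      using strict_mono_block_start[OF assms] by (simp add: strict_mono_Suc_iff)
    with m show ?case
      by (metis Suc_lessI le_SucI order_le_less)
  qed
  then obtain m where "block_start x y c m \<le> i" "i < block_start x y c (Suc m)" by blast
  then show ?thesis
    using that[of m "i - block_start x y c m"] by (simp add: block_start_Suc)
qed

lemma image_of_block:
  assumes "image_of b x y c"
  shows "occurs_at (case_letter x y (b i)) c (block_start x y b i)"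
proof -
  have "occurs_at (morph x y (map b [0..<Suc i])) c 0"
    using assms by (simp only: image_of_def)
  then show ?thesis
    by (simp add: morph_append morph_Cons occurs_at_append block_start_def)
qed

lemma image_ofI:
  assumes "\<And>i. occurs_at (case_letter x y (b i)) c (block_start x y b i)"
  shows "image_of b x y c"
  unfolding image_of_def
proof
  fix i
  show "occurs_at (morph x y (map b [0..<i])) c 0"
    using assms by (induction i) (simp_all add: morph_append morph_Cons occurs_at_append block_start_def)
qed

lemma image_of_map: "image_of b x y c \<Longrightarrow>
    map c [0..<block_start x y b i] = morph x y (map b [0..<i])"
  using occurs_at_map[of "morph x y (map b [0..<i])" c 0] by (simp add: image_of_def block_start_def)

text \<open>The inner image of a prefix of \<open>a\<close> is a prefix of \<open>b\<close>, to
  which the outer substitution applies. Levels of blocks are composed in this way.\<close>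

lemma image_of_comp:
  assumes "image_of a x' y' b" "image_of b x y c"
  shows "image_of a (morph x y x') (morph x y y') c"
  unfolding image_of_def
proof
  fix i
  have "morph (morph x y x') (morph x y y') (map a [0..<i]) =
      morph x y (map b [0..<block_start x' y' a i])"
    by (simp add: image_of_map[OF assms(1)] morph_morph)
  then show "occurs_at (morph (morph x y x') (morph x y y') (map a [0..<i])) c 0"
    using assms(2) by (simp add: image_of_def)
qed

lemma block_start_comp:
  assumes "image_of a x' y' b"
  shows "block_start (morph x y x') (morph x y y') a i = block_start x y b (block_start x' y' a i)"
  unfolding block_start_def[of "morph x y x'"] block_start_def[of x]
  by (simp add: image_of_map[OF assms] morph_morph)

section \<open>Continued fractions\<close>

lemma convergent_cf_cong:
  "(\<And>i. i \<ge> 1 \<Longrightarrow> a i = b i) \<Longrightarrow> convergent_cf a m = convergent_cf b m"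
proof (induction m arbitrary: a b)
  case (Suc m)
  have "convergent_cf (\<lambda>i. a (Suc i)) m = convergent_cf (\<lambda>i. b (Suc i)) m"
    using Suc.prems by (intro Suc.IH) simp
  then show ?case using Suc.prems[of 1] by simp
qed simp

lemma cf_cong: "(\<And>i. i \<ge> 1 \<Longrightarrow> a i = b i) \<Longrightarrow> cf a = cf b"
  unfolding cf_def by (rule arg_cong[of _ _ lim]) (rule ext, rule convergent_cf_cong)

lemma convergent_cf_bounds:
  assumes "\<forall>i\<ge>1. a i \<ge> 1"
  shows "0 \<le> convergent_cf a m" "convergent_cf a m \<le> 1"
proof -
  have "0 \<le> convergent_cf a m \<and> convergent_cf a m \<le> 1"
    using assms
  proof (induction m arbitrary: a)
    case (Suc m)
    have "0 \<le> convergent_cf (\<lambda>i. a (Suc i)) m" using Suc.IH[of "\<lambda>i. a (Suc i)"] Suc.prems by simp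
    moreover have "real (a 1) \<ge> 1" using Suc.prems by simp
    ultimately show ?case by simp
  qed simp
  then show "0 \<le> convergent_cf a m" "convergent_cf a m \<le> 1" by auto
qed

text \<open>Two successive steps of the continued fraction contract distances by a factor 4.\<close>

lemma convergent_cf_dist:
  assumes "\<forall>i\<ge>1. a i \<ge> 1"
  shows "\<bar>convergent_cf a (2 * m + j) - convergent_cf a (2 * m)\<bar> \<le> (1 / 4) ^ m"
  using assms
proof (induction m arbitrary: a)
  case 0
  then show ?case using convergent_cf_bounds[of a j] by simp
next
  case (Suc m)
  let ?a = "\<lambda>i. a (Suc (Suc i))"
  define p q where "p = real (a 1)" and "q = real (a 2)"
  define X Y where "X = convergent_cf ?a (2 * m + j)" and "Y = convergent_cf ?a (2 * m)"
  have pq: "p \<ge> 1" "q \<ge> 1" using Suc.prems by (simp_all add: p_def q_def)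
  have XY: "X \<ge> 0" "Y \<ge> 0"
    using convergent_cf_bounds(1)[of ?a] Suc.prems by (simp_all add: X_def Y_def)
  have eq: "convergent_cf a (2 * Suc m + j) = 1 / (p + 1 / (q + X))"
    "convergent_cf a (2 * Suc m) = 1 / (p + 1 / (q + Y))"
    by (simp_all add: p_def q_def X_def Y_def numeral_2_eq_2)
  have ge2: "p * (q + Z) + 1 \<ge> 2" if "Z \<ge> 0" for Z
    using mult_mono[of 1 p 1 "q + Z"] pq that by simp
  have frac: "1 / (p + 1 / (q + Z)) = (q + Z) / (p * (q + Z) + 1)" if "Z \<ge> 0" for Z
  proof -
    have "p + 1 / (q + Z) = (p * (q + Z) + 1) / (q + Z)" using pq that by (simp add: field_simps)
    then show ?thesis by simp
  qed
  \<comment> \<open>Both fractions are values of one Moebius map of determinant 1, so their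
    difference is \<open>X - Y\<close> over the product of the denominators, each of which is at
    least 2.\<close>
  define D where "D = (p * (q + X) + 1) * (p * (q + Y) + 1)"
  have "1 / (p + 1 / (q + X)) - 1 / (p + 1 / (q + Y)) = (X - Y) / D"
    unfolding frac[OF XY(1)] frac[OF XY(2)] D_def using ge2[OF XY(1)] ge2[OF XY(2)]
    by (subst diff_frac_eq) (auto simp: algebra_simps)
  moreover have "D \<ge> 2 * 2"
    unfolding D_def using ge2[OF XY(1)] ge2[OF XY(2)] by (intro mult_mono) auto
  moreover have "\<bar>X - Y\<bar> / D \<le> \<bar>X - Y\<bar> / 4"
    using \<open>D \<ge> 2 * 2\<close> by (intro frac_le) auto
  ultimately have "\<bar>1 / (p + 1 / (q + X)) - 1 / (p + 1 / (q + Y))\<bar> \<le> \<bar>X - Y\<bar> / 4"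
    by simp
  moreover have "\<bar>X - Y\<bar> \<le> (1 / 4) ^ m"
    unfolding X_def Y_def using Suc.IH[of ?a] Suc.prems by simp
  ultimately show ?case unfolding eq by simp
qed

lemma convergent_cf_LIMSEQ:
  assumes "\<forall>i\<ge>1. a i \<ge> 1"
  shows "convergent_cf a \<longlonglongrightarrow> cf a"
proof -
  have "Cauchy (convergent_cf a)"
  proof (rule metric_CauchyI)
    fix e :: real
    assume "e > 0"
    then obtain m where m: "(1 / 4) ^ m < e / 2"
      using real_arch_pow_inv[of "e / 2" "1 / 4"] by auto
    have *: "\<bar>convergent_cf a i - convergent_cf a (2 * m)\<bar> < e / 2" if "i \<ge> 2 * m" for i
      using convergent_cf_dist[OF assms, of m "i - 2 * m"] that m by simp
    show "\<exists>M. \<forall>i\<ge>M. \<forall>j\<ge>M. dist (convergent_cf a i) (convergent_cf a j) < e"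
    proof (intro exI allI impI)
      fix i j assume "i \<ge> 2 * m" "j \<ge> 2 * m"
      from *[OF this(1)] *[OF this(2)] show "dist (convergent_cf a i) (convergent_cf a j) < e"
        unfolding dist_real_def by linarith
    qed
  qed
  then have "convergent (convergent_cf a)" by (simp add: Cauchy_convergent_iff)
  then show ?thesis by (simp add: cf_def convergent_LIMSEQ_iff)
qed

text \<open>The recursion of the convergents passes to the limit, because the limit of the tail is
  nonnegative and keeps the denominator away from 0.\<close>

lemma cf_unfold:
  assumes "\<forall>i\<ge>1. a i \<ge> 1"
  shows "cf a = 1 / (real (a 1) + cf (\<lambda>i. a (Suc i)))" "cf a > 0" "cf a \<le> 1"
proof -
  have nonneg: "cf b \<ge> 0" if "\<forall>i\<ge>1. b i \<ge> 1" for b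
    using convergent_cf_LIMSEQ[OF that] convergent_cf_bounds(1)[OF that]
    by (intro LIMSEQ_le_const[of "convergent_cf b"]) auto
  have 1: "real (a 1) \<ge> 1" using assms by simp
  have 2: "cf (\<lambda>i. a (Suc i)) \<ge> 0" using nonneg assms by simp
  have "(\<lambda>m. convergent_cf a (Suc m)) \<longlonglongrightarrow> 1 / (real (a 1) + cf (\<lambda>i. a (Suc i)))"
    using convergent_cf_LIMSEQ[of "\<lambda>i. a (Suc i)"] assms 1 2
    by (auto intro!: tendsto_intros)
  moreover have "(\<lambda>m. convergent_cf a (Suc m)) \<longlonglongrightarrow> cf a"
    using convergent_cf_LIMSEQ[OF assms] by (rule LIMSEQ_Suc)
  ultimately show "cf a = 1 / (real (a 1) + cf (\<lambda>i. a (Suc i)))"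
    using LIMSEQ_unique by blast
  with 1 2 show "cf a > 0" "cf a \<le> 1" by simp_all
qed

lemma cf_less_1:
  assumes "\<forall>i\<ge>1. a i \<ge> 1"
  shows "cf a < 1"
proof -
  have "cf (\<lambda>i. a (Suc i)) > 0" "real (a 1) \<ge> 1"
    using cf_unfold(2)[of "\<lambda>i. a (Suc i)"] assms by simp_all
  then show ?thesis using cf_unfold(1)[OF assms] by simp
qed

section \<open>Characteristic words\<close>

lemma image_of_letterwise:
  assumes "\<And>i. c i = case_letter x y (b i)"
  shows "image_of b [x] [y] c"
proof (rule image_ofI)
  fix i
  have "block_start [x] [y] b i = i"
    by (induction i) (simp_all add: block_start_Suc split: letter.split)
  then show "occurs_at (case_letter [x] [y] (b i)) c (block_start [x] [y] b i)"
    using assms[of i] by (simp add: occurs_at_def split: letter.split)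
qed

text \<open>For irrational \<open>\<gamma>\<close> no positive multiple of it is an integer, so the
  floors of \<open>m * \<gamma>\<close> and \<open>m * (1 - \<gamma>)\<close> add up to
  \<open>m - 1\<close>. Exactly one of the two jumps at each step, which exchanges the
  letters.\<close>

lemma char_word_complement:
  assumes "\<gamma> \<notin> \<rat>" "0 < \<gamma>" "\<gamma> < 1"
  shows "image_of (char_word \<gamma>) [B] [A] (char_word (1 - \<gamma>))"
proof (rule image_of_letterwise)
  fix i
  have floor: "\<lfloor>real m * (1 - \<gamma>)\<rfloor> = int m - 1 - \<lfloor>real m * \<gamma>\<rfloor>" if "m \<ge> 1" for m
  proof -
    have "real m * \<gamma> \<notin> \<int>"
    proof
      assume "real m * \<gamma> \<in> \<int>"
      then have "real m * \<gamma> \<in> \<rat>" by (rule Ints_subset_Rats[THEN subsetD])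
      then have "real m * \<gamma> / real m \<in> \<rat>" by (rule Rats_divide) simp
      then show False using assms(1) that by simp
    qed
    then have "frac (real m * \<gamma>) > 0" by (simp only: frac_gt_0_iff not_False_eq_True)
    then have "real_of_int \<lfloor>real m * \<gamma>\<rfloor> < real m * \<gamma>" by (simp add: frac_def)
    moreover have "real m * (1 - \<gamma>) = real m - real m * \<gamma>" by (simp add: algebra_simps)
    moreover have "real m * \<gamma> < real_of_int \<lfloor>real m * \<gamma>\<rfloor> + 1" by linarith
    ultimately show ?thesis by (intro floor_unique; simp; linarith)
  qed
  define f g where "f = \<lfloor>real (i + 1) * \<gamma>\<rfloor>" and "g = \<lfloor>real (i + 2) * \<gamma>\<rfloor>"
  have "real (i + 2) * \<gamma> = real (i + 1) * \<gamma> + \<gamma>" by (simp add: algebra_simps)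
  then have "f \<le> g" "g \<le> f + 1" using assms(2,3) unfolding f_def g_def by linarith+
  moreover have "\<lfloor>real (i + 1) * (1 - \<gamma>)\<rfloor> = int i - f"
    "\<lfloor>real (i + 2) * (1 - \<gamma>)\<rfloor> = int i + 1 - g"
    using floor[of "i + 1"] floor[of "i + 2"] by (simp_all add: f_def g_def)
  ultimately show "char_word (1 - \<gamma>) i = (case char_word \<gamma> i of A \<Rightarrow> B | B \<Rightarrow> A)"
    unfolding char_word_def f_def[symmetric] g_def[symmetric] by simp
qed

text \<open>The floor \<open>f i\<close> counts the letters B before position \<open>i\<close>, so
  block \<open>i\<close> starts at \<open>j = i + f i\<close>. After clearing the denominator
  \<open>1 + \<gamma>\<close>, the floors of the multiples \<open>j + 1\<close>,
  \<open>j + 2\<close> and \<open>j + 3\<close> of the new slope follow from the bounds on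
  \<open>f\<close>.\<close>

lemma char_word_shift:
  assumes "0 < \<gamma>" "\<gamma> < 1"
  shows "image_of (char_word \<gamma>) [A] [A, B] (char_word (\<gamma> / (1 + \<gamma>)))"
proof (rule image_ofI)
  fix i
  define f where "f i = \<lfloor>real (i + 1) * \<gamma>\<rfloor>" for i
  have f: "real_of_int (f i) \<le> real (i + 1) * \<gamma>" "real (i + 1) * \<gamma> < real_of_int (f i) + 1" for i
    unfolding f_def by linarith+
  have f_Suc: "f (Suc i) = (if char_word \<gamma> i = A then f i else f i + 1)" for i
  proof -
    have "real (Suc i + 1) * \<gamma> = real (i + 1) * \<gamma> + \<gamma>" by (simp add: algebra_simps)
    then have "f i \<le> f (Suc i)" "f (Suc i) \<le> f i + 1"
      using assms unfolding f_def by linarith+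
    moreover have "char_word \<gamma> i = (if f (Suc i) - f i = 0 then A else B)"
      by (simp add: char_word_def f_def)
    ultimately show ?thesis by simp
  qed
  have start: "int (block_start [A] [A, B] (char_word \<gamma>) i) = int i + f i" for i
  proof (induction i)
    case 0
    show ?case using assms by (simp add: f_def floor_eq_iff)
  next
    case (Suc i)
    then show ?case by (simp add: block_start_Suc f_Suc split: letter.split)
  qed
  define j where "j = block_start [A] [A, B] (char_word \<gamma>) i"
  have j: "real j = real i + real_of_int (f i)"
    using start[of i] by (metis j_def of_int_add of_int_of_nat_eq)
  have floor: "\<lfloor>x * (\<gamma> / (1 + \<gamma>))\<rfloor> = g"
    if "real_of_int g * (1 + \<gamma>) \<le> x * \<gamma>" "x * \<gamma> < (real_of_int g + 1) * (1 + \<gamma>)" for x g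
    using that assms by (intro floor_unique) (simp_all add: field_simps)
  have 1: "\<lfloor>real (j + 1) * (\<gamma> / (1 + \<gamma>))\<rfloor> = f i"
    using f[of i] assms by (intro floor) (auto simp: j algebra_simps)
  have 2: "\<lfloor>real (j + 2) * (\<gamma> / (1 + \<gamma>))\<rfloor> = f i"
    using f[of i] assms by (intro floor) (auto simp: j algebra_simps)
  have 3: "\<lfloor>real (j + 3) * (\<gamma> / (1 + \<gamma>))\<rfloor> = f i + 1" if "char_word \<gamma> i = B"
    using f[of "Suc i"] f_Suc[of i] that assms by (intro floor) (auto simp: j algebra_simps)
  have "char_word (\<gamma> / (1 + \<gamma>)) j = A"
    using 1 2 by (simp add: char_word_def)
  moreover have "char_word (\<gamma> / (1 + \<gamma>)) (Suc j) = B" if "char_word \<gamma> i = B"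
    using 2 3[OF that] by (simp add: char_word_def numeral_3_eq_3)
  ultimately show "occurs_at (case_letter [A] [A, B] (char_word \<gamma> i)) (char_word (\<gamma> / (1 + \<gamma>)))
      (block_start [A] [A, B] (char_word \<gamma>) i)"
    by (auto simp: occurs_at_def less_Suc_eq simp flip: j_def split: letter.split)
qed

text \<open>Each application of \<open>char_word_shift\<close> puts one more A in front of every B
  and adds 1 to the reciprocal of the slope.\<close>

lemma char_word_shift_iterate:
  assumes "0 < \<delta>" "\<delta> < 1"
  shows "image_of (char_word \<delta>) [A] (replicate m A @ [B]) (char_word (\<delta> / (1 + real m * \<delta>)))"
proof (induction m)
  case 0
  show ?case by (simp, rule image_of_letterwise) (simp split: letter.split)
next
  case (Suc m)
  define \<gamma> where "\<gamma> = \<delta> / (1 + real m * \<delta>)"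
  have pos: "1 + real m * \<delta> > 0" using assms by (simp add: add_pos_nonneg)
  have "\<gamma> > 0" unfolding \<gamma>_def using assms pos by simp
  have "real m * \<delta> \<ge> 0" using assms by simp
  then have "\<delta> < 1 + real m * \<delta>" using assms by linarith
  then have "\<gamma> < 1" unfolding \<gamma>_def using pos by simp
  have *: "\<gamma> / (1 + \<gamma>) = \<delta> / (1 + real (Suc m) * \<delta>)"
  proof -
    have "1 + \<gamma> = (1 + real (Suc m) * \<delta>) / (1 + real m * \<delta>)"
      unfolding \<gamma>_def using pos by (simp add: field_simps)
    then show ?thesis unfolding \<gamma>_def using pos by simp
  qed
  have "image_of (char_word \<delta>) (morph [A] [A, B] [A]) (morph [A] [A, B] (replicate m A @ [B]))
      (char_word (\<gamma> / (1 + \<gamma>)))"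
    using Suc.IH char_word_shift[OF \<open>\<gamma> > 0\<close> \<open>\<gamma> < 1\<close>] unfolding \<gamma>_def by (rule image_of_comp)
  moreover have "morph [A] [A, B] (replicate m A @ [B]) = replicate (Suc m) A @ [B]"
    by (induction m) (simp_all add: morph_Cons)
  ultimately show ?case by (simp add: * morph_Cons)
qed

text \<open>Every block begins with A, and B appears only as the second letter of a block AB, hence
  just before the start of the next block.\<close>

lemma image_of_shift:
  assumes "image_of a [A] [A, B] b"
  shows "b m = A \<longleftrightarrow> m \<in> range (block_start [A] [A, B] a)"
    and "b m = B \<Longrightarrow> b (Suc m) = A"
proof -
  have start: "b (block_start [A] [A, B] a i) = A" for i
    using image_of_block[OF assms, of i]
    by (auto simp: occurs_at_def split: letter.splits dest: spec[of _ 0])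
  obtain i k where i: "m = block_start [A] [A, B] a i + k"
    "k < length (case_letter [A] [A, B] (a i))"
    by (rule block_cover[of "[A]" "[A, B]" m a]) simp_all
  have *: "b m = B \<and> Suc m = block_start [A] [A, B] a (Suc i)" if "k \<noteq> 0"
  proof -
    have "a i = B" "k = 1" using i that by (simp_all split: letter.splits)
    then show ?thesis
      using image_of_block[OF assms, of i] i
      by (auto simp: occurs_at_def block_start_Suc dest: spec[of _ "Suc 0"])
  qed
  show "b m = A \<longleftrightarrow> m \<in> range (block_start [A] [A, B] a)"
    using * start i by (cases "k = 0") auto
  show "b (Suc m) = A" if "b m = B"
    using * start i that by (cases "k = 0") auto
qed

section \<open>Standard words\<close>

definition end_letter :: "nat \<Rightarrow> letter" where
  "end_letter m = (if even m then B else A)"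

lemma end_letter_Suc_Suc [simp]: "end_letter (Suc (Suc m)) = end_letter m"
  by (simp add: end_letter_def)

lemma end_letter_Suc_neq: "end_letter (Suc m) \<noteq> end_letter m"
  by (simp add: end_letter_def)

lemma s_shifted_last: "s_shifted d m = butlast (s_shifted d m) @ [end_letter m]"
proof -
  have "s_shifted d m \<noteq> [] \<and> last (s_shifted d m) = end_letter m"
    by (induction d m rule: s_shifted.induct) (simp_all add: end_letter_def)
  then show ?thesis by (metis append_butlast_last_id)
qed

lemma s_shifted_nonempty [simp]: "s_shifted d m \<noteq> []"
  using s_shifted_last[of d m] by auto

lemma concat_replicate_commute: "xs @ concat (replicate k xs) = concat (replicate k xs) @ xs"
  by (induction k) simp_all

text \<open>Both products of consecutive standard words begin with the same power of the shorter
  one. Removing it leaves the two products one level lower with their roles exchanged.\<close>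

lemma s_shifted_commute:
  "\<exists>y. s_shifted d (Suc m) @ s_shifted d m = y @ [end_letter (Suc m), end_letter m] \<and>
       s_shifted d m @ s_shifted d (Suc m) = y @ [end_letter m, end_letter (Suc m)]"
proof (induction m)
  case 0
  show ?case by (simp add: end_letter_def)
next
  case (Suc m)
  then obtain y where y: "s_shifted d (Suc m) @ s_shifted d m = y @ [end_letter (Suc m), end_letter m]"
    "s_shifted d m @ s_shifted d (Suc m) = y @ [end_letter m, end_letter (Suc m)]" by blast
  let ?R = "concat (replicate (d (Suc m)) (s_shifted d (Suc m)))"
  have "s_shifted d (Suc (Suc m)) @ s_shifted d (Suc m) =
      (?R @ y) @ [end_letter (Suc (Suc m)), end_letter (Suc m)]"
    using y(2) by simp
  moreover have "s_shifted d (Suc m) @ s_shifted d (Suc (Suc m)) =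
      ?R @ (s_shifted d (Suc m) @ s_shifted d m)"
    using concat_replicate_commute[of "s_shifted d (Suc m)" "d (Suc m)"]
    by (simp flip: append_assoc)
  ultimately show ?case using y(1) by auto
qed

section \<open>Letter counts and distinctness of conjugates\<close>

lemma count_list_concat_replicate:
  "count_list (concat (replicate k xs)) x = k * count_list xs x"
  by (induction k) simp_all

text \<open>The recursion adds a multiple of one row of the matrix of letter counts to the other and
  exchanges the rows, so the determinant only changes sign.\<close>

lemma s_shifted_det:
  "int (count_list (s_shifted d (Suc m)) A) * int (count_list (s_shifted d m) B) -
   int (count_list (s_shifted d (Suc m)) B) * int (count_list (s_shifted d m) A) = (- 1) ^ m"
proof (induction m)
  case (Suc m)
  then show ?case by (simp add: count_list_concat_replicate algebra_simps)
qed simp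

lemma count_list_rotate: "count_list (rotate k xs) x = count_list xs x"
proof -
  have "count_list (drop j xs) x + count_list (take j xs) x = count_list xs x" for j
    by (metis add.commute append_take_drop_id count_list_append)
  then show ?thesis by (simp add: rotate_drop_take)
qed

text \<open>A word fixed by a proper rotation is a product of two commuting nonempty words, hence a
  proper power. Its exponent divides all letter counts, against the Bezout relation in the last
  hypothesis.\<close>

lemma rotate_eq_imp_eq:
  fixes xs :: "'a list"
  assumes "rotate i xs = rotate j xs" "i < length xs" "j < length xs"
    and "p * int (count_list xs a) + q * int (count_list xs b) = 1"
  shows "i = j"
proof -
  have less: False if "i < j" "rotate i xs = rotate j xs" "j < length xs" for i j
  proof -
    define k where "k = j - i"
    have k: "0 < k" "k < length xs" using that by (auto simp: k_def)
    have "rotate (length xs - i) (rotate i xs) = rotate (length xs - i) (rotate i (rotate k xs))"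
      using that by (simp add: rotate_rotate k_def)
    moreover have "rotate (length xs - i) (rotate i ys) = ys" if "length ys = length xs" for ys :: "'a list"
      using \<open>i < j\<close> \<open>j < length xs\<close> that by (simp add: rotate_rotate rotate_id)
    ultimately have "rotate k xs = xs" by simp
    then have "drop k xs @ take k xs = take k xs @ drop k xs"
      using k by (simp add: rotate_drop_take)
    then obtain m n zs where zs: "concat (replicate m zs) = take k xs" "concat (replicate n zs) = drop k xs"
      using comm_append_are_replicate[of "take k xs" "drop k xs"] by metis
    have "m \<noteq> 0" "n \<noteq> 0" using zs k by (auto intro: ccontr)
    have "xs = concat (replicate (m + n) zs)"
      using zs by (simp add: replicate_add)
    then have count: "count_list xs x = (m + n) * count_list zs x" for x
      by (metis count_list_concat_replicate)
    have "int (m + n) dvd p * int (count_list xs a) + q * int (count_list xs b)"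
      by (simp only: count of_nat_mult) (simp add: dvd_add)
    then show False using assms(4) \<open>m \<noteq> 0\<close> \<open>n \<noteq> 0\<close> by auto
  qed
  show ?thesis using less[of i j] less[of j i] assms(1-3) by (cases i j rule: linorder_cases) auto
qed

lemma rotate_s_shifted_eq_imp_eq:
  assumes "rotate i (s_shifted d (Suc m)) = rotate j (s_shifted d (Suc m))"
    and "i < length (s_shifted d (Suc m))" "j < length (s_shifted d (Suc m))"
  shows "i = j"
proof -
  let ?a = "int (count_list (s_shifted d m) A)" and ?b = "int (count_list (s_shifted d m) B)"
  \<comment> \<open>The Bezout coefficients are the letter counts of the preceding standard word,
    with the sign of the determinant.\<close>
  have "(- 1) ^ m * ?b * int (count_list (s_shifted d (Suc m)) A) +
      (- ((- 1) ^ m * ?a)) * int (count_list (s_shifted d (Suc m)) B) = (- 1) ^ m * (- 1) ^ m"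
    unfolding s_shifted_det[of d m, symmetric] by (simp add: algebra_simps)
  also have "\<dots> = 1" by (simp flip: power_mult_distrib)
  finally show ?thesis using rotate_eq_imp_eq[OF assms] by blast
qed

section \<open>Occurrences of conjugates\<close>

text \<open>Here \<open>s\<close> and \<open>t\<close> stand for consecutive standard words, and
  \<open>c\<close> is cut into blocks \<open>s\<close> and \<open>t\<close> according to
  \<open>b\<close>. Only the facts needed to locate the conjugates of \<open>s\<close> are
  kept.\<close>

context
  fixes s t y :: "'a list" and x x' :: 'a
    and b :: "letter infinite_word" and c :: "'a infinite_word"
  assumes prefix: "\<exists>r. s = t @ r"
    and t_nonempty: "t \<noteq> []"
    and s_t: "s @ t = y @ [x, x']"
    and t_s: "t @ s = y @ [x', x]"
    and x_neq: "x \<noteq> x'"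
    and rotate_inj: "\<And>i j. rotate i s = rotate j s \<Longrightarrow> i < length s \<Longrightarrow> j < length s \<Longrightarrow> i = j"
    and image: "image_of b s t c"
    and no_BB: "\<And>m. b m = B \<Longrightarrow> b (Suc m) = A"
begin

lemma nonempty: "s \<noteq> []" "length t \<ge> 1"
  using prefix t_nonempty by (auto simp: Suc_le_eq)

text \<open>The word \<open>s @ butlast s\<close> contains the conjugates at all offsets below
  \<open>length s\<close>, so it suffices to find it at the start of the block. If the next block is
  \<open>t\<close>, then \<open>t @ s\<close> follows, which begins with \<open>y\<close>; and
  \<open>y\<close> agrees with \<open>s\<close> on the first \<open>length s - 1\<close>
  letters.\<close>

lemma occurs_rotate_A:
  assumes "b m = A" "k < length s"
  shows "occurs_at (rotate k s) c (block_start s t b m + k)"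
proof -
  have "\<exists>r. occurs_at (s @ butlast s @ r) c (block_start s t b m)"
  proof (cases "b (Suc m)")
    case A
    have "occurs_at (s @ s) c (block_start s t b m)"
      using image_of_block[OF image, of m] image_of_block[OF image, of "Suc m"] assms A
      by (simp add: occurs_at_append block_start_Suc)
    moreover have "s @ s = s @ butlast s @ [last s]" using nonempty by simp
    ultimately show ?thesis by metis
  next
    case B
    have "occurs_at (s @ t @ s) c (block_start s t b m)"
      using image_of_block[OF image, of m] image_of_block[OF image, of "Suc m"]
        image_of_block[OF image, of "Suc (Suc m)"] assms B no_BB[OF B]
      by (simp add: occurs_at_append block_start_Suc add.assoc)
    then have occ: "occurs_at (s @ y @ [x', x]) c (block_start s t b m)" by (simp add: t_s)
    have "length s + length t = length y + 2" using arg_cong[OF s_t, of length] by simp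
    \<comment> \<open>This bound uses only that \<open>t\<close> is nonempty: the two letters lost
      from \<open>s @ t\<close> reach at most one letter into \<open>s\<close>.\<close>
    then have le: "length s - 1 \<le> length y" using nonempty by simp
    have "take (length s - 1) y = take (length s - 1) (s @ t)" using le by (simp add: s_t)
    then have "take (length s - 1) y = butlast s" by (simp add: butlast_conv_take)
    then have "y = butlast s @ drop (length s - 1) y" by (metis append_take_drop_id)
    then show ?thesis using occ by (metis append.assoc)
  qed
  then obtain r where r: "occurs_at (s @ butlast s @ r) c (block_start s t b m)" by blast
  have "butlast s = take k s @ drop k (butlast s)"
    using assms(2) append_take_drop_id[of k "butlast s"] by (simp add: take_butlast)
  then have "s @ butlast s = (take k s @ drop k s) @ (take k s @ drop k (butlast s))"
    unfolding append_take_drop_id by (rule arg_cong)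
  then have "s @ butlast s = take k s @ rotate k s @ drop k (butlast s)"
    using assms(2) by (simp add: rotate_drop_take del: append_take_drop_id)
  then have "occurs_at (take k s @ rotate k s @ drop k (butlast s)) c (block_start s t b m)"
    using r by (metis occurs_at_append append.assoc)
  then show ?thesis using assms(2) by (simp add: occurs_at_append)
qed

lemma occurs_t_s:
  assumes "b m = B"
  shows "occurs_at (t @ s) c (block_start s t b m)"
  using image_of_block[OF image, of m] image_of_block[OF image, of "Suc m"] assms no_BB[OF assms]
  by (simp add: occurs_at_append block_start_Suc)

text \<open>The products \<open>t @ s\<close> and \<open>s @ t\<close> share the prefix
  \<open>y\<close>, which lacks only the last two letters. In \<open>s @ t\<close> the conjugate at
  offset \<open>k\<close> is followed by \<open>drop k t\<close>, which has at least two letters, so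
  it lies inside \<open>y\<close>.\<close>

lemma occurs_rotate_B:
  assumes "b m = B" "k + 2 \<le> length t"
  shows "occurs_at (rotate k s) c (block_start s t b m + k)"
proof -
  obtain r where r: "s = t @ r" using prefix by blast
  have "k < length s" using assms r by simp
  have "s @ t = take k s @ drop k s @ take k t @ drop k t" by (simp flip: append_assoc)
  also have "take k t = take k s" using assms r by simp
  finally have "s @ t = take k s @ rotate k s @ drop k t"
    using \<open>k < length s\<close> by (simp add: rotate_drop_take)
  moreover have "butlast (butlast (s @ t)) = y" by (simp add: s_t butlast_append)
  moreover have "drop k t \<noteq> []" "butlast (drop k t) \<noteq> []"
    using assms(2) by (auto simp flip: length_0_conv)
  ultimately have "y = take k s @ rotate k s @ butlast (butlast (drop k t))"
    by (simp add: butlast_append)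
  then have "occurs_at (take k s @ rotate k s) c (block_start s t b m)"
    using occurs_t_s[OF assms(1)] by (simp add: t_s occurs_at_append)
  then show ?thesis using \<open>k < length s\<close> by (simp add: occurs_at_append)
qed

text \<open>The factor at the last letter of a t-block is the only factor of that length that is not
  a conjugate of s: compared with s, one letter x is replaced by x'.\<close>

lemma not_occurs_rotate:
  assumes "b m = B"
  shows "\<not> occurs_at (rotate k s) c (block_start s t b m + (length t - 1))"
proof
  assume occ: "occurs_at (rotate k s) c (block_start s t b m + (length t - 1))"
  have last: "last s = x" "last t = x'"
    using arg_cong[OF t_s, of last] arg_cong[OF s_t, of last] nonempty t_nonempty by simp_all
  have s: "s = butlast s @ [x]" and t: "t = butlast t @ [x']"
    using nonempty t_nonempty last by (metis append_butlast_last_id)+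
  have "t @ s = butlast t @ (x' # butlast s) @ [x]"
    by (subst s, subst t) simp
  then have "occurs_at (x' # butlast s) c (block_start s t b m + (length t - 1))"
    using occurs_t_s[OF assms] by (simp only: occurs_at_append length_butlast)
  then have "rotate k s = x' # butlast s"
    using occ nonempty by (intro occurs_at_unique) auto
  then have "count_list s x = count_list (x' # butlast s) x" by (metis count_list_rotate)
  moreover have "count_list s x = count_list (butlast s @ [x]) x" using s by simp
  ultimately show False using x_neq by simp
qed

text \<open>Each position has an offset \<open>j\<close> in some block. Outside the last offset of a
  \<open>t\<close>-block the factor there is the conjugate number \<open>j\<close>, and distinctness
  of conjugates forces \<open>j = k\<close>.\<close>

lemma occurs_rotateD:
  assumes "occurs_at (rotate k s) c i" "k < length s"
  shows "\<exists>m. i = k + block_start s t b m \<and> (b m = B \<longrightarrow> k + 2 \<le> length t)"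
proof -
  obtain m j where j: "i = block_start s t b m + j" "j < length (case_letter s t (b m))"
    by (rule block_cover[of s t i b]) (use nonempty t_nonempty in simp_all)
  have le: "length t \<le> length s" using prefix by auto
  have eq: "k = j" if "occurs_at (rotate j s) c i" "j < length s"
    using occurs_at_unique[OF assms(1) that(1)] rotate_inj assms(2) that(2) by simp
  show ?thesis
  proof (cases "b m")
    case A
    then have "k = j" using j occurs_rotate_A[OF A, of j] eq by simp
    then show ?thesis using j A by auto
  next
    case B
    then have "j \<noteq> length t - 1" using not_occurs_rotate[OF B, of k] assms(1) j by auto
    then have "j + 2 \<le> length t" using j B by simp
    then have "k = j" using j occurs_rotate_B[OF B, of j] eq le by simp
    then show ?thesis using j \<open>j + 2 \<le> length t\<close> by auto
  qed
qed

lemma occurrences_short: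
  assumes "k + 2 \<le> length t"
  shows "{i. occurs_at (rotate k s) c i} = range (\<lambda>m. k + block_start s t b m)"
proof -
  have "k < length s" using assms prefix by auto
  then have "occurs_at (rotate k s) c (k + block_start s t b m)" for m
    using occurs_rotate_A[of m k] occurs_rotate_B[of m k] assms
    by (cases "b m") (simp_all add: add.commute)
  then show ?thesis using occurs_rotateD \<open>k < length s\<close> by blast
qed

lemma occurrences_long:
  assumes "length t \<le> k + 1" "k < length s"
  shows "{i. occurs_at (rotate k s) c i} = (\<lambda>m. k + block_start s t b m) ` {m. b m = A}"
proof -
  have "b m = A" if "b m = B \<longrightarrow> k + 2 \<le> length t" for m
    using that assms by (cases "b m") auto
  then have "{i. occurs_at (rotate k s) c i} \<subseteq> (\<lambda>m. k + block_start s t b m) ` {m. b m = A}"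
    using occurs_rotateD assms(2) by blast
  moreover have "occurs_at (rotate k s) c (k + block_start s t b m)" if "b m = A" for m
    using occurs_rotate_A[OF that assms(2)] by (simp add: add.commute)
  ultimately show ?thesis by blast
qed

end

section \<open>Decompositions from conjugation identities\<close>

lemma word_abs: "word xs = abs_free_group (positive xs)"
  by (rule word.abs_eq)

text \<open>The last two hypotheses say that conjugation by the prefix turns each factor
  \<open>w z\<close> into a block. The partial products then telescope to an image of a prefix of
  \<open>b\<close> followed by \<open>p\<close>, a positive and hence reduced word.\<close>

lemma decompositionI:
  assumes image: "image_of b x y c" and nonempty: "x \<noteq> []" "y \<noteq> []"
    and occ: "{i. occurs_at w c i} = range (\<lambda>m. length p + block_start x y b m)"
    and zA: "word p * (word w * zA) = word x * word p"
    and zB: "word p * (word w * zB) = word y * word p"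
  shows "decomposition c (word p) w (subst_word b zA zB)"
proof -
  let ?z = "subst_word b zA zB"
  have z: "word p * (word w * ?z i) = word (case_letter x y (b i)) * word p" for i
    using zA zB by (simp add: subst_word_def split: letter.split)
  have prod: "word p * (\<Prod>j\<leftarrow>[0..<i]. word w * ?z j) = word (morph x y (map b [0..<i])) * word p" for i
  proof (induction i)
    case 0
    show ?case by (simp add: word_Nil)
  next
    case (Suc i)
    have "word p * (\<Prod>j\<leftarrow>[0..<Suc i]. word w * ?z j) =
        word p * (\<Prod>j\<leftarrow>[0..<i]. word w * ?z j) * (word w * ?z i)"
      by (simp add: mult.assoc)
    also have "\<dots> = word (morph x y (map b [0..<i])) * (word p * (word w * ?z i))"
      by (simp only: Suc.IH mult.assoc)
    also have "\<dots> = word (morph x y (map b [0..<Suc i])) * word p"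
      by (simp only: z) (simp add: morph_append morph_Cons word_append mult.assoc)
    finally show ?case .
  qed
  have mono: "strict_mono (block_start x y b)"
    using nonempty by (rule strict_mono_block_start)
  have "tends_to_word (\<lambda>i. word p * (\<Prod>j\<leftarrow>[0..<i]. word w * ?z j)) c"
    unfolding tends_to_word_def
  proof
    fix N
    have "\<exists>ys. reduced (positive (map c [0..<N]) @ ys) \<and>
        word p * (\<Prod>j\<leftarrow>[0..<i]. word w * ?z j) = abs_free_group (positive (map c [0..<N]) @ ys)"
      if "i \<ge> N" for i
    proof -
      let ?M = "block_start x y b i"
      \<comment> \<open>Blocks are nonempty, so \<open>i\<close> of them cover at least
        \<open>i\<close> letters of \<open>c\<close>.\<close>
      have "N \<le> ?M" using that strict_mono_imp_increasing[OF mono, of i] by simp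
      then have "map c [0..<?M] = map c [0..<N] @ map c [N..<?M]"
        by (metis le0 le_add_diff_inverse map_append upt_add_eq_append)
      then have "word p * (\<Prod>j\<leftarrow>[0..<i]. word w * ?z j) =
          word (map c [0..<N] @ map c [N..<?M] @ p)"
        unfolding prod image_of_map[OF image, symmetric] by (simp add: word_append mult.assoc)
      then have "word p * (\<Prod>j\<leftarrow>[0..<i]. word w * ?z j) =
          abs_free_group (positive (map c [0..<N]) @ positive (map c [N..<?M] @ p))"
        by (simp add: word_abs positive_def)
      moreover have "reduced (positive (map c [0..<N]) @ positive (map c [N..<?M] @ p))"
        using reduced_positive[of "map c [0..<N] @ map c [N..<?M] @ p"] by (simp add: positive_def)
      ultimately show ?thesis by blast
    qed
    then show "\<forall>\<^sub>F i in sequentially. \<exists>ys. reduced (positive (map c [0..<N]) @ ys) \<and>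
        word p * (\<Prod>j\<leftarrow>[0..<i]. word w * ?z j) = abs_free_group (positive (map c [0..<N]) @ ys)"
      by (rule eventually_sequentiallyI)
  qed
  \<comment> \<open>Taking lengths in the conjugation identity cancels the length of
    \<open>p\<close> and leaves the gap between consecutive occurrences.\<close>
  moreover have "int (length p + block_start x y b (Suc i)) =
      int (length p + block_start x y b i) + int (length w) + fg_length (?z i)" for i
    using arg_cong[OF z[of i], of fg_length]
    by (simp add: fg_length_mult fg_length_word block_start_Suc)
  moreover have "strict_mono (\<lambda>m. length p + block_start x y b m)"
    using mono by (simp add: strict_mono_def)
  ultimately show ?thesis
    unfolding decomposition_def using occ
    by (intro conjI exI[of _ "\<lambda>m. length p + block_start x y b m"]) (auto simp: fg_length_word)
qed

section \<open>The characteristic word as an image\<close>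

context
  fixes d :: "nat \<Rightarrow> nat"
  assumes d_pos: "\<forall>i\<ge>1. d i \<ge> 1"
begin

text \<open>For n >= 1, tail_slope n is alpha(n) and block_slope n is alpha(n,1); block_slope 0 is alpha.\<close>

definition tail_slope :: "nat \<Rightarrow> real" where
  "tail_slope n = cf (\<lambda>i. d (n + i))"

lemma tail_slope_unfold: "tail_slope n = 1 / (real (d (n + 1)) + tail_slope (n + 1))"
  using cf_unfold(1)[of "\<lambda>i. d (n + i)"] d_pos by (simp add: tail_slope_def)

lemma tail_slope_bounds: "0 < tail_slope n" "tail_slope n < 1"
  using cf_unfold(2)[of "\<lambda>i. d (n + i)"] cf_less_1[of "\<lambda>i. d (n + i)"] d_pos
  by (simp_all add: tail_slope_def)

lemma tail_slope_irrational:
  assumes "tail_slope 0 \<notin> \<rat>"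
  shows "tail_slope n \<notin> \<rat>"
proof (induction n)
  case (Suc n)
  show ?case
  proof
    assume "tail_slope (Suc n) \<in> \<rat>"
    then have "1 / (real (d (n + 1)) + tail_slope (Suc n)) \<in> \<rat>"
      by (intro Rats_divide Rats_add Rats_1 Rats_of_nat)
    with Suc show False using tail_slope_unfold[of n] by simp
  qed
qed (fact assms)

definition block_slope :: "nat \<Rightarrow> real" where
  "block_slope n = tail_slope n / (1 + tail_slope n)"

text \<open>Raising the first partial quotient by 1 adds 1 to the reciprocal, which sends a slope
  \<open>g\<close> to \<open>g / (1 + g)\<close>.\<close>

lemma block_slope_eq_cf:
  assumes "a 1 = Suc (d (n + 1))" "\<And>i. i \<ge> 2 \<Longrightarrow> a i = d (n + i)"
  shows "cf a = block_slope n"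
proof -
  have "cf (\<lambda>i. a (Suc i)) = tail_slope (n + 1)"
    unfolding tail_slope_def using assms(2) by (intro cf_cong) simp
  moreover have "\<forall>i\<ge>1. a i \<ge> 1"
  proof (intro allI impI)
    fix i :: nat assume "i \<ge> 1"
    then show "a i \<ge> 1" using assms d_pos by (cases "i = 1") auto
  qed
  ultimately have "cf a = 1 / (real (d (n + 1)) + tail_slope (n + 1) + 1)"
    using cf_unfold(1)[of a] assms(1) by (simp add: add.commute add.left_commute)
  also have "real (d (n + 1)) + tail_slope (n + 1) = 1 / tail_slope n"
    using tail_slope_unfold[of n] tail_slope_bounds[of "n + 1"] by simp
  also have "1 / (1 / tail_slope n + 1) = block_slope n"
    using tail_slope_bounds[of n] by (simp add: block_slope_def field_simps)
  finally show ?thesis .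
qed

lemma image_of_block_slope: "image_of (char_word (tail_slope n)) [A] [A, B] (char_word (block_slope n))"
  unfolding block_slope_def by (rule char_word_shift) (rule tail_slope_bounds)+

text \<open>Exchanging the letters replaces the slope by \<open>\<delta> = 1 / (1 + g)\<close>, and
  \<open>d (Suc n)\<close> shifts raise its reciprocal to that of \<open>block_slope n\<close>. The
  composite substitution mirrors the recursion of the standard words.\<close>

lemma image_of_block_slope_Suc:
  assumes "tail_slope 0 \<notin> \<rat>"
  shows "image_of (char_word (block_slope (Suc n))) (replicate (d (Suc n)) A @ [B]) [A] (char_word (block_slope n))"
proof -
  define g where "g = tail_slope (Suc n)"
  define \<delta> where "\<delta> = 1 - block_slope (Suc n)"
  have g: "0 < g" "g < 1" unfolding g_def by (rule tail_slope_bounds)+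
  have \<delta>: "\<delta> = 1 / (1 + g)" using g by (simp add: \<delta>_def block_slope_def g_def field_simps)
  have "block_slope (Suc n) \<notin> \<rat>"
  proof
    assume *: "block_slope (Suc n) \<in> \<rat>"
    have "g = block_slope (Suc n) / (1 - block_slope (Suc n))"
      using g by (simp add: block_slope_def g_def[symmetric] field_simps)
    also have "\<dots> \<in> \<rat>" using * by (intro Rats_divide Rats_diff Rats_1)
    finally show False using tail_slope_irrational[OF assms, of "Suc n"] by (simp add: g_def)
  qed
  moreover have "0 < block_slope (Suc n)" "block_slope (Suc n) < 1"
    using g by (simp_all add: block_slope_def g_def[symmetric])
  ultimately have 1: "image_of (char_word (block_slope (Suc n))) [B] [A] (char_word \<delta>)"
    unfolding \<delta>_def by (rule char_word_complement)
  define D where "D = real (d (Suc n)) + g"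
  have "D > 0" using g by (simp add: D_def add_nonneg_pos)
  moreover have "tail_slope n = 1 / D" using tail_slope_unfold[of n] by (simp add: D_def g_def)
  ultimately have "block_slope n = 1 / (D + 1)"
    using tail_slope_bounds[of n] by (simp add: block_slope_def field_simps)
  also have "\<dots> = \<delta> / (1 + real (d (Suc n)) * \<delta>)"
    using g by (simp add: D_def \<delta> field_simps add_pos_nonneg)
  finally have "block_slope n = \<delta> / (1 + real (d (Suc n)) * \<delta>)" .
  then have 2: "image_of (char_word \<delta>) [A] (replicate (d (Suc n)) A @ [B]) (char_word (block_slope n))"
    using char_word_shift_iterate[of \<delta> "d (Suc n)"] g by (simp add: \<delta>)
  show ?thesis using image_of_comp[OF 1 2] by (simp add: morph_Cons)
qed

lemma image_of_s_shifted:
  assumes "tail_slope 0 \<notin> \<rat>"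
  shows "image_of (char_word (block_slope n)) (s_shifted d (Suc n)) (s_shifted d n) (char_word (block_slope 0))"
proof (induction n)
  case 0
  show ?case by (simp, rule image_of_letterwise) (simp split: letter.split)
next
  case (Suc n)
  show ?case
    using image_of_comp[OF image_of_block_slope_Suc[OF assms] Suc]
    by (simp add: morph_append morph_replicate morph_Cons)
qed

section \<open>The words w, v and U in the free group\<close>

definition E :: "nat \<Rightarrow> letter free_group" where
  "E m = word [end_letter m]"

lemma E_Suc_Suc [simp]: "E (Suc (Suc m)) = E m"
  by (simp add: E_def)

abbreviation S :: "nat \<Rightarrow> letter free_group" where
  "S m \<equiv> word (s_shifted d m)"

lemma word_butlast_s: "word (butlast (s_shifted d m)) = S m * inverse (E m)"
  by (subst (2) s_shifted_last) (simp add: word_append E_def free_group_simps)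

lemma S_Suc_Suc: "S (Suc (Suc m)) = S (Suc m) ^ d (Suc m) * S m"
  by (simp add: word_append word_concat_replicate)

text \<open>The formula also covers the exceptional value at index -1: there the standard word is
  the single letter B, which cancels against \<open>E 0\<close>.\<close>

lemma w_word_eq: "w_word d (int m - 1) = E (Suc m) * S m * inverse (E m)"
proof (cases m)
  case 0
  then show ?thesis by (simp add: w_word_def E_def end_letter_def free_group_simps)
next
  case (Suc k)
  then show ?thesis by (simp add: w_word_def E_def end_letter_def s_word_def nat_add_distrib)
qed

lemma v_word_expand:
  "v_word d (int m - 1) = E (Suc m) * S (Suc m) ^ (d (Suc m) - 1) * S m * inverse (E m)"
proof -
  have "nat (int m - 1 + 2) = Suc m" "int m - 1 + 1 = int m" "nat (int m + 1) = Suc m" by simp_all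
  then show ?thesis by (simp add: v_word_def E_def end_letter_def s_word_def)
qed

text \<open>The recursion of the standard words absorbs the power with exponent
  \<open>d (Suc m) - 1\<close>, so the later identities involve no exponents.\<close>

lemma v_word_eq: "v_word d (int m - 1) = E (Suc m) * inverse (S (Suc m)) * S (Suc (Suc m)) * inverse (E m)"
proof -
  obtain k where "d (Suc m) = Suc k" using d_pos by (metis Suc_le_D le_add1 plus_1_eq_Suc One_nat_def)
  then show ?thesis
    unfolding v_word_expand S_Suc_Suc by (simp add: free_group_simps)
qed

text \<open>The product telescopes by \<open>v_word_eq\<close>, since \<open>E\<close> has period
  two. For \<open>m = 0\<close> the product is empty and both factors on the right are the letter
  A.\<close>

lemma prod_v_word:
  "(\<Prod>j\<leftarrow>[- 1..int m - 2]. v_word d j) = S (Suc m) * inverse (E (Suc m))"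
proof (induction m)
  case 0
  show ?case by (simp add: E_def end_letter_def free_group_simps)
next
  case (Suc m)
  have "[- 1..int (Suc m) - 2] = [- 1..int m - 2] @ [int m - 1]"
    using upto_rec2[of "- 1" "int m - 1"] by simp
  then have "(\<Prod>j\<leftarrow>[- 1..int (Suc m) - 2]. v_word d j) =
      S (Suc m) * inverse (E (Suc m)) * v_word d (int m - 1)"
    using Suc by simp
  then show ?case by (simp add: v_word_eq free_group_simps del: s_shifted.simps)
qed

lemma power_conj: "(x * y * inverse x) ^ k = x * y ^ k * inverse x" for x y :: "'a free_group"
  by (induction k) (simp_all add: free_group_simps)

text \<open>The product of \<open>w\<close> and \<open>v\<close> inside \<open>U\<close> is a
  conjugate of \<open>S n\<close>, so its power is explicit. The case \<open>d n = 1\<close> falls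
  under the separate value of \<open>U\<close> at -1, and the same formula results.\<close>

lemma U_word_eq:
  assumes "n \<ge> 2"
  shows "U_word d (int n - 1) (int (d n) - 2) =
    E n * inverse (S n) * inverse (S n) * S (Suc n) * inverse (E (Suc n))"
proof -
  obtain m where n: "n = Suc (Suc m)" using assms by (cases n; cases "n - 1") auto
  have w: "w_word d (int n - 2) = E m * S (Suc m) * inverse (E (Suc m))"
    using w_word_eq[of "Suc m"] by (simp add: n)
  have v: "v_word d (int n - 3) = E (Suc m) * inverse (S (Suc m)) * S n * inverse (E m)"
    using v_word_eq[of m] by (simp add: n del: s_shifted.simps)
  have S: "S (Suc n) = S n ^ d n * S (Suc m)" using S_Suc_Suc[of "Suc m"] by (simp add: n)
  have "d n \<ge> 1" using d_pos n by simp
  then consider "d n = 1" | k where "d n = Suc (Suc k)"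
    by (cases "d n"; cases "d n - 1") auto
  then show ?thesis
  proof cases
    case 1
    then show ?thesis
      unfolding S by (simp add: U_word_def v free_group_simps) (simp add: n)
  next
    case 2
    have "w_word d (int n - 2) * v_word d (int n - 3) = E m * S n * inverse (E m)"
      unfolding v w by (simp add: free_group_simps)
    then have "U_word d (int n - 1) (int (d n) - 2) = (E m * S n * inverse (E m)) ^ k * w_word d (int n - 2)"
      using 2 by (simp add: U_word_def)
    then show ?thesis
      unfolding S power_conj w 2 by (simp add: free_group_simps) (simp add: n)
  qed
qed

section \<open>Positive words representing w and v\<close>

definition W_list :: "nat \<Rightarrow> letter list" where
  "W_list n = end_letter (Suc n) # butlast (s_shifted d n)"

definition V_list :: "nat \<Rightarrow> letter list" where
  "V_list m = end_letter (Suc m) #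
     butlast (concat (replicate (d (Suc m) - 1) (s_shifted d (Suc m))) @ s_shifted d m)"

text \<open>The inverse letter at the end of \<open>w\<close> cancels the last letter of the
  standard word, so a positive word remains.\<close>

lemma word_W_list: "word (W_list n) = w_word d (int n - 1)"
  unfolding W_list_def w_word_eq
  by (subst word_Cons) (simp add: word_butlast_s E_def free_group_simps)

lemma word_V_list: "word (V_list m) = v_word d (int m - 1)"
  unfolding V_list_def v_word_expand
  by (subst word_Cons)
    (simp add: butlast_append word_append word_concat_replicate word_butlast_s E_def[symmetric] free_group_simps)

text \<open>The first letter of \<open>V_list m\<close> is exactly the last letter missing from
  \<open>butlast (s_shifted d (Suc m))\<close>. So the product is the next standard word with its
  last letter moved to the front.\<close>

lemma W_V_list: "W_list (Suc m) @ V_list m = end_letter m # butlast (s_shifted d (Suc (Suc m)))"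
proof -
  have d: "d (Suc m) = Suc (d (Suc m) - 1)" using d_pos[rule_format, of "Suc m"] by simp
  have "butlast (s_shifted d (Suc m)) @ V_list m =
      (butlast (s_shifted d (Suc m)) @ [end_letter (Suc m)]) @
      butlast (concat (replicate (d (Suc m) - 1) (s_shifted d (Suc m))) @ s_shifted d m)"
    by (simp add: V_list_def)
  also have "\<dots> = butlast (s_shifted d (Suc m) @ concat (replicate (d (Suc m) - 1) (s_shifted d (Suc m))) @ s_shifted d m)"
    by (simp add: butlast_append flip: s_shifted_last)
  also have "\<dots> = butlast (s_shifted d (Suc (Suc m)))"
    by (simp only: s_shifted.simps) (subst (2) d, simp)
  finally show ?thesis by (simp add: W_list_def)
qed

lemma length_W_list: "length (W_list n) = length (s_shifted d n)"
  by (simp add: W_list_def)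

text \<open>Moving the last letter to the front costs one rotation, which is why \<open>v\<close>
  has length \<open>k + 1\<close> in the first case.\<close>

lemma rotate_eq_W_V:
  "rotate k (s_shifted d (Suc (Suc m))) = rotate (Suc k) (W_list (Suc m) @ V_list m)"
proof -
  have "s_shifted d (Suc (Suc m)) = rotate1 (W_list (Suc m) @ V_list m)"
    unfolding W_V_list using s_shifted_last[of d "Suc (Suc m)"] by simp
  then show ?thesis by (simp add: rotate1_rotate_swap del: s_shifted.simps)
qed

section \<open>The decompositions for short and long conjugates\<close>

context
  fixes n :: nat
  assumes irrational: "tail_slope 0 \<notin> \<rat>" and n_ge_1: "n \<ge> 1"
begin

lemma s_shifted_prefix: "\<exists>r. s_shifted d (Suc n) = s_shifted d n @ r"
proof -
  obtain m where n: "n = Suc m" using n_ge_1 by (cases n) auto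
  obtain k where "d (Suc m) = Suc k" using d_pos[rule_format, of "Suc m"] by (cases "d (Suc m)") auto
  then show ?thesis by (simp add: n)
qed

lemma
  shows occurrences_s_short: "k + 2 \<le> length (s_shifted d n) \<Longrightarrow>
      {i. occurs_at (rotate k (s_shifted d (Suc n))) (char_word (block_slope 0)) i} =
      range (\<lambda>m. k + block_start (s_shifted d (Suc n)) (s_shifted d n) (char_word (block_slope n)) m)"
    and occurrences_s_long: "length (s_shifted d n) \<le> k + 1 \<Longrightarrow> k < length (s_shifted d (Suc n)) \<Longrightarrow>
      {i. occurs_at (rotate k (s_shifted d (Suc n))) (char_word (block_slope 0)) i} =
      (\<lambda>m. k + block_start (s_shifted d (Suc n)) (s_shifted d n) (char_word (block_slope n)) m) `
        {m. char_word (block_slope n) m = A}"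
proof -
  obtain y where y:
    "s_shifted d (Suc n) @ s_shifted d n = y @ [end_letter (Suc n), end_letter n]"
    "s_shifted d n @ s_shifted d (Suc n) = y @ [end_letter n, end_letter (Suc n)]"
    using s_shifted_commute by blast
  note facts = s_shifted_prefix s_shifted_nonempty y end_letter_Suc_neq rotate_s_shifted_eq_imp_eq
    image_of_s_shifted[OF irrational] image_of_shift(2)[OF image_of_block_slope]
  show "{i. occurs_at (rotate k (s_shifted d (Suc n))) (char_word (block_slope 0)) i} =
      range (\<lambda>m. k + block_start (s_shifted d (Suc n)) (s_shifted d n) (char_word (block_slope n)) m)"
    if "k + 2 \<le> length (s_shifted d n)"
    by (rule occurrences_short[OF facts that])
  show "{i. occurs_at (rotate k (s_shifted d (Suc n))) (char_word (block_slope 0)) i} =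
      (\<lambda>m. k + block_start (s_shifted d (Suc n)) (s_shifted d n) (char_word (block_slope n)) m) `
        {m. char_word (block_slope n) m = A}"
    if "length (s_shifted d n) \<le> k + 1" "k < length (s_shifted d (Suc n))"
    by (rule occurrences_long[OF facts that])
qed

lemma W_V_list': "W_list n @ V_list (n - 1) = end_letter (Suc n) # butlast (s_shifted d (Suc n))"
proof -
  obtain m where "n = Suc m" using n_ge_1 by (cases n) auto
  then show ?thesis using W_V_list[of m] by (simp del: s_shifted.simps)
qed

lemma rotate_eq_W_V':
  "rotate k (s_shifted d (Suc n)) = rotate (Suc k) (W_list n @ V_list (n - 1))"
proof -
  obtain m where "n = Suc m" using n_ge_1 by (cases n) auto
  then show ?thesis using rotate_eq_W_V[of k m] by (simp del: s_shifted.simps)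
qed

lemma word_V_list': "word (V_list (n - 1)) = v_word d (int n - 2)"
proof -
  obtain m where "n = Suc m" using n_ge_1 by (cases n) auto
  then show ?thesis using word_V_list[of m] by simp
qed

lemma v_word_eq': "v_word d (int n - 2) = E n * inverse (S n) * S (Suc n) * inverse (E (Suc n))"
proof -
  obtain m where "n = Suc m" using n_ge_1 by (cases n) auto
  then show ?thesis using v_word_eq[of m] by (simp del: s_shifted.simps)
qed

lemma prod_v_word':
  "(\<Prod>j\<leftarrow>[- 1..int n - 3]. v_word d j) = S n * inverse (E n)"
proof -
  obtain m where "n = Suc m" using n_ge_1 by (cases n) auto
  then show ?thesis using prod_v_word[of m] by (simp del: s_shifted.simps)
qed

lemma short_conjugate:
  assumes k: "k + 2 \<le> length (s_shifted d n)"
    and vu: "word v * word u = w_word d (int n - 1)" and v: "length v = k + 1"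
  defines "w \<equiv> rotate k (s_shifted d (Suc n))"
  shows "word w = word u * v_word d (int n - 2) * word v"
    and "decomposition (char_word (block_slope 0))
      ((\<Prod>j\<leftarrow>[- 1..int n - 3]. v_word d j) * inverse (word u)) w
      (subst_word (char_word (block_slope n)) 1
        (inverse (word u * U_word d (int n - 1) (int (d n) - 2) * word v)))"
proof -
  \<comment> \<open>For \<open>n = 1\<close> the word \<open>s_shifted d n\<close> has only one
    letter; \<open>U_word_eq\<close> requires \<open>n\<close> to be at least 2.\<close>
  have "n \<noteq> 1" using k by auto
  then have n: "n \<ge> 2" using n_ge_1 by simp
  have W: "W_list n = v @ u"
    using vu by (intro inj_word) (simp add: word_append word_W_list)
  have "w = rotate (length v) (v @ (u @ V_list (n - 1)))"
    unfolding w_def rotate_eq_W_V' v W by simp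
  then have "w = u @ V_list (n - 1) @ v" by (simp only: rotate_append append_assoc)
  then show w: "word w = word u * v_word d (int n - 2) * word v"
    by (simp add: word_append word_V_list' mult.assoc del: One_nat_def)
  \<comment> \<open>The prefix of the decomposition is \<open>v\<close> without its first letter;
    its length is \<open>k\<close>, the offset of the occurrences in the blocks.\<close>
  obtain p where p: "v = end_letter (Suc n) # p" "butlast (s_shifted d n) = p @ u"
    using W v by (cases v) (auto simp: W_list_def)
  have "S n * inverse (E n) = word p * word u"
    by (simp add: p(2) flip: word_butlast_s word_append)
  then have word_p: "word p = S n * inverse (E n) * inverse (word u)"
    by (simp add: free_group_simps)
  have "word v = word v * word u * inverse (word u)" by (simp add: free_group_simps)
  then have word_v: "word v = E (Suc n) * S n * inverse (E n) * inverse (word u)"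
    unfolding vu w_word_eq .
  have "decomposition (char_word (block_slope 0)) (word p) w
    (subst_word (char_word (block_slope n)) 1
      (inverse (word u * U_word d (int n - 1) (int (d n) - 2) * word v)))"
  \<comment> \<open>Written in \<open>S\<close> and \<open>E\<close>, both conjugation identities
    hold by free cancellation.\<close>
  proof (rule decompositionI[OF image_of_s_shifted[OF irrational]])
    show "{i. occurs_at w (char_word (block_slope 0)) i} =
      range (\<lambda>m. length p + block_start (s_shifted d (Suc n)) (s_shifted d n) (char_word (block_slope n)) m)"
      using occurrences_s_short[OF k] v p(1) by (simp add: w_def)
  qed (simp_all only: s_shifted_nonempty not_False_eq_True w word_p word_v v_word_eq' U_word_eq[OF n],
      simp_all add: free_group_simps del: s_shifted.simps)
  then show "decomposition (char_word (block_slope 0))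
      ((\<Prod>j\<leftarrow>[- 1..int n - 3]. v_word d j) * inverse (word u)) w
      (subst_word (char_word (block_slope n)) 1
        (inverse (word u * U_word d (int n - 1) (int (d n) - 2) * word v)))"
    by (simp only: prod_v_word' word_p)
qed

lemma long_conjugate:
  assumes k: "length (s_shifted d n) \<le> k + 1" "k < length (s_shifted d (Suc n))"
    and vu: "word v * word u = v_word d (int n - 2)"
    and v: "length (s_shifted d n) + length v = k + 1"
  defines "w \<equiv> rotate k (s_shifted d (Suc n))"
  shows "word w = word u * w_word d (int n - 1) * word v"
    and "decomposition (char_word (block_slope 0))
      ((\<Prod>j\<leftarrow>[- 1..int n - 2]. v_word d j) * inverse (word u)) w
      (subst_word (char_word (tail_slope n)) 1
        (inverse (word v) * w_word d (int n) * inverse (word u)))"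
proof -
  let ?s = "s_shifted d (Suc n)" and ?t = "s_shifted d n"
  have V: "V_list (n - 1) = v @ u"
    using vu by (intro inj_word) (simp add: word_append word_V_list' del: One_nat_def)
  have "w = rotate (length (W_list n @ v)) ((W_list n @ v) @ u)"
    unfolding w_def rotate_eq_W_V' V using v by (simp add: length_W_list)
  then have "w = u @ W_list n @ v" by (simp only: rotate_append)
  then show w: "word w = word u * w_word d (int n - 1) * word v"
    by (simp add: word_append word_W_list mult.assoc)
  \<comment> \<open>This is the part of \<open>butlast ?s\<close> before \<open>u\<close>; dropping
    one letter of \<open>?t\<close> makes its length exactly \<open>k\<close>.\<close>
  define p where "p = butlast ?t @ v"
  have p: "butlast ?s = p @ u"
    using W_V_list' unfolding V by (simp add: W_list_def p_def)
  have length_p: "length p = k"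
  proof -
    have "length ?t \<ge> 1" by (simp add: Suc_le_eq)
    then show ?thesis using v by (simp add: p_def)
  qed
  have "S (Suc n) * inverse (E (Suc n)) = word p * word u"
    by (simp add: p flip: word_butlast_s word_append)
  then have word_p: "word p = S (Suc n) * inverse (E (Suc n)) * inverse (word u)"
    by (simp add: free_group_simps)
  have "word v = word v * word u * inverse (word u)" by (simp add: free_group_simps)
  then have word_v: "word v = E n * inverse (S n) * S (Suc n) * inverse (E (Suc n)) * inverse (word u)"
    unfolding vu v_word_eq' .
  have w_n: "w_word d (int n) = E n * S (Suc n) * inverse (E (Suc n))"
    using w_word_eq[of "Suc n"] by (simp del: s_shifted.simps)
  \<comment> \<open>Blocks \<open>?t\<close> contain no occurrence, so each is joined to the block
    \<open>?s\<close> before it. This regrouping has slope \<open>tail_slope n\<close>, and its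
    block starts are the starts of the blocks \<open>?s\<close>.\<close>
  have image: "image_of (char_word (tail_slope n)) ?s (?s @ ?t) (char_word (block_slope 0))"
    using image_of_comp[OF image_of_block_slope image_of_s_shifted[OF irrational]]
    by (simp add: morph_Cons del: s_shifted.simps)
  have start: "block_start ?s (?s @ ?t) (char_word (tail_slope n)) i =
      block_start ?s ?t (char_word (block_slope n)) (block_start [A] [A, B] (char_word (tail_slope n)) i)" for i
    using block_start_comp[OF image_of_block_slope, of ?s ?t n i]
    by (simp add: morph_Cons del: s_shifted.simps)
  have "{m. char_word (block_slope n) m = A} = range (block_start [A] [A, B] (char_word (tail_slope n)))"
    using image_of_shift(1)[OF image_of_block_slope] by blast
  then have occ: "{i. occurs_at w (char_word (block_slope 0)) i} =
      range (\<lambda>m. length p + block_start ?s (?s @ ?t) (char_word (tail_slope n)) m)"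
    using occurrences_s_long[OF k] by (simp only: w_def length_p start image_image)
  have "decomposition (char_word (block_slope 0)) (word p) w
    (subst_word (char_word (tail_slope n)) 1
      (inverse (word v) * w_word d (int n) * inverse (word u)))"
    by (rule decompositionI[OF image _ _ occ])
      (simp_all only: w word_p word_v w_word_eq w_n word_append,
        simp_all add: free_group_simps del: s_shifted.simps)
  then show "decomposition (char_word (block_slope 0))
      ((\<Prod>j\<leftarrow>[- 1..int n - 2]. v_word d j) * inverse (word u)) w
      (subst_word (char_word (tail_slope n)) 1
        (inverse (word v) * w_word d (int n) * inverse (word u)))"
    by (simp only: prod_v_word word_p)
qed

end

section \<open>The slopes as continued fractions\<close>

lemma block_slope_eq_cf_quotients: "cf (quotients d) = block_slope 0"
  by (rule block_slope_eq_cf) (simp_all add: quotients_def)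

lemma block_slope_eq_cf_tail: "n \<ge> 1 \<Longrightarrow> cf_tail (quotients d) n 1 = block_slope n"
  unfolding cf_tail_def by (rule block_slope_eq_cf) (simp_all add: quotients_def nat_add_distrib)

lemma tail_slope_eq_cf_tail: "n \<ge> 1 \<Longrightarrow> cf_tail (quotients d) n 0 = tail_slope n"
  unfolding cf_tail_def tail_slope_def by (rule cf_cong) (auto simp: quotients_def)

lemma tail_slope_0_irrational: "cf (quotients d) \<notin> \<rat> \<Longrightarrow> tail_slope 0 \<notin> \<rat>"
  unfolding block_slope_eq_cf_quotients block_slope_def
  by (metis Rats_1 Rats_add Rats_divide)

end

theorem theorem6p2:
  fixes d :: "nat \<Rightarrow> nat" and \<alpha> :: real and n :: nat
  assumes d_pos: "\<And>i. i \<ge> 1 \<Longrightarrow> d i \<ge> 1"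
    and \<alpha>_cf: "\<alpha> = cf (quotients d)"
    and \<alpha>_irrational: "\<alpha> \<notin> \<rat>"
    and n_ge_1: "n \<ge> 1"
  shows
    "(\<forall>(k :: nat) (w :: letter list).
        int k \<le> q_len d (int n - 1) - 2 \<longrightarrow> w = rotate k (s_word d (int n)) \<longrightarrow>
        (\<exists>u v. word v * word u = w_word d (int n - 1) \<and> length v = k + 1) \<and>
        (\<forall>u v. word v * word u = w_word d (int n - 1) \<longrightarrow> length v = k + 1 \<longrightarrow>
           word w = word u * v_word d (int n - 2) * word v \<and>
           decomposition (char_word \<alpha>)
             ((\<Prod>j\<leftarrow>[- 1..int n - 3]. v_word d j) * inverse (word u)) w
             (subst_word (char_word (cf_tail (quotients d) n 1)) 1
                (inverse (word u * U_word d (int n - 1) (int (d n) - 2) * word v)))))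
   \<and>
     (\<forall>(k :: nat) (w :: letter list).
        q_len d (int n - 1) - 1 \<le> int k \<longrightarrow> int k \<le> q_len d (int n) - 1 \<longrightarrow>
        w = rotate k (s_word d (int n)) \<longrightarrow>
        (\<exists>u v. word v * word u = v_word d (int n - 2) \<and>
                 int (length v) = int k + 1 - q_len d (int n - 1)) \<and>
        (\<forall>u v. word v * word u = v_word d (int n - 2) \<longrightarrow>
                 int (length v) = int k + 1 - q_len d (int n - 1) \<longrightarrow>
           word w = word u * w_word d (int n - 1) * word v \<and>
           decomposition (char_word \<alpha>)
             ((\<Prod>j\<leftarrow>[- 1..int n - 2]. v_word d j) * inverse (word u)) w
             (subst_word (char_word (cf_tail (quotients d) n 0)) 1
                (inverse (word v) * w_word d (int n) * inverse (word u)))))"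
proof -
  have d: "\<forall>i\<ge>1. d i \<ge> 1" using d_pos by blast
  have irrational: "tail_slope d 0 \<notin> \<rat>"
    using tail_slope_0_irrational[OF d] \<alpha>_irrational \<alpha>_cf by simp
  note slopes = \<alpha>_cf block_slope_eq_cf_quotients[OF d] block_slope_eq_cf_tail[OF d n_ge_1]
    tail_slope_eq_cf_tail[OF d n_ge_1]
  have s: "s_word d (int n) = s_shifted d (Suc n)" "s_word d (int n - 1) = s_shifted d n"
    by (simp_all add: s_word_def nat_add_distrib)
  have length_W: "length (W_list d n) = length (s_shifted d n)"
    using length_W_list[OF d] .
  have length_V: "length (s_shifted d n) + length (V_list d (n - 1)) = length (s_shifted d (Suc n))"
    using arg_cong[OF W_V_list'[OF d irrational n_ge_1], of length]
    by (simp add: length_W del: s_shifted.simps)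
  show ?thesis
    unfolding slopes s q_len_def
  proof (intro conjI allI impI)
    fix k assume "int k \<le> int (length (s_shifted d n)) - 2"
    then have k: "k + 2 \<le> length (s_shifted d n)" by linarith
    show "\<exists>u v. word v * word u = w_word d (int n - 1) \<and> length v = k + 1"
      using k length_W
      \<comment> \<open>The word for \<open>w\<close> is cut after \<open>k + 1\<close> letters,
        which its length permits.\<close>
      by (intro exI[of _ "drop (k + 1) (W_list d n)"] exI[of _ "take (k + 1) (W_list d n)"])
        (simp add: word_W_list[OF d] flip: word_append)
  next
    fix k w u v
    assume "int k \<le> int (length (s_shifted d n)) - 2" and w: "w = rotate k (s_shifted d (Suc n))"
      and vu: "word v * word u = w_word d (int n - 1)" "length v = k + 1"
    then have k: "k + 2 \<le> length (s_shifted d n)" by linarith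
    show "word w = word u * v_word d (int n - 2) * word v"
      and "decomposition (char_word (block_slope d 0))
        ((\<Prod>j\<leftarrow>[- 1..int n - 3]. v_word d j) * inverse (word u)) w
        (subst_word (char_word (block_slope d n)) 1
          (inverse (word u * U_word d (int n - 1) (int (d n) - 2) * word v)))"
      unfolding w by (fact short_conjugate[OF d irrational n_ge_1 k vu])+
  next
    fix k
    assume "int (length (s_shifted d n)) - 1 \<le> int k" "int k \<le> int (length (s_shifted d (Suc n))) - 1"
    then have k: "length (s_shifted d n) \<le> k + 1" "k < length (s_shifted d (Suc n))" by linarith+
    define V where "V = V_list d (n - 1)"
    \<comment> \<open>The natural subtraction is exact by the first bound in \<open>k\<close>; the
      second bound and \<open>length_V\<close> give \<open>j \<le> length V\<close>.\<close>
    define j where "j = k + 1 - length (s_shifted d n)"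
    have "j \<le> length V" and j: "int j = int k + 1 - int (length (s_shifted d n))"
      using k length_V unfolding V_def j_def by linarith+
    then show "\<exists>u v. word v * word u = v_word d (int n - 2) \<and>
        int (length v) = int k + 1 - int (length (s_shifted d n))"
      using word_V_list'[OF d irrational n_ge_1]
      by (intro exI[of _ "drop j V"] exI[of _ "take j V"]) (simp add: V_def flip: word_append)
  next
    fix k w u v
    assume "int (length (s_shifted d n)) - 1 \<le> int k" "int k \<le> int (length (s_shifted d (Suc n))) - 1"
      and w: "w = rotate k (s_shifted d (Suc n))"
      and vu: "word v * word u = v_word d (int n - 2)"
      and "int (length v) = int k + 1 - int (length (s_shifted d n))"
    then have k: "length (s_shifted d n) \<le> k + 1" "k < length (s_shifted d (Suc n))"
      and v: "length (s_shifted d n) + length v = k + 1" by linarith+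
    show "word w = word u * w_word d (int n - 1) * word v"
      and "decomposition (char_word (block_slope d 0))
        ((\<Prod>j\<leftarrow>[- 1..int n - 2]. v_word d j) * inverse (word u)) w
        (subst_word (char_word (tail_slope d n)) 1
          (inverse (word v) * w_word d (int n) * inverse (word u)))"
      unfolding w by (fact long_conjugate[OF d irrational n_ge_1 k vu v])+
  qed
qed

end
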